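(* Let $\mathbb{F}_{q_1}$ and $\mathbb{F}_{q_2}$ be finite fields of odd characteristic, and for $i=1,2$ let $\nu_i\ge0$ be an integer and $\delta_i\in\{0,1,2\}$ with $2\nu_i+\delta_i\geq 2$. Then $Oi(2\nu_1+\delta_1,q_1)\cong Oi(2\nu_2+\delta_2,q_2)$ as graphs if and only if $\nu_1=\nu_2$, $\delta_1=\delta_2$ and $q_1=q_2$.
   Context: For a finite field $\mathbb{F}_q$ of odd characteristic, fix a non-square $z\in\mathbb{F}_q^*$. Let $S=S_{2\nu+\delta,\Delta}$ be the $(2\nu+\delta)\times(2\nu+\delta)$ nonsingular symmetric block matrix $$S_{2\nu+\delta,\Delta}=\begin{pmatrix}0&I^{(\nu)}&\\ I^{(\nu)}&0&\\ &&\Delta\end{pmatrix},$$ where $\Delta=\emptyset$ (omitted) if $\delta=0$, $\Delta=(1)$ or $(z)$ if $\delta=1$, and $\Delta=\mathrm{diag}(1,-z)$ if $\delta=2$. A subspace of the row space $\mathbb{F}_q^{(2\nu+\delta)}$ is identified with any matrix whose rows form a basis of it. The orthogonal inner product graph $Oi(2\nu+\delta,q)$ (with respect to $S$) has as vertices all non-trivial subspaces of $\mathbb{F}_q^{(2\nu+\delta)}$ (i.e. different from $0$ and from the whole space), with an edge between vertices $A$ and $B$ if and only if $AS\,{}^t\!B=0$. Loops are allowed ($A$ is adjacent to itself when $AS\,{}^t\!A=0$), and graph isomorphisms preserve adjacency and non-adjacency, loops included. *)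

theory Defs
  imports
    "HOL-Library.Cardinality"
    "Jordan_Normal_Form.VS_Connect"
    "Graph_Theory.Digraph_Isomorphism"
    "Graph_Theory.Pair_Digraph"
begin

text \<open>The admissible blocks \<open>\<Delta>\<close> for a given non-square \<open>z\<close>; there are two of them when \<open>\<delta> = 1\<close>.\<close>

definition Delta_blocks :: "'a::field \<Rightarrow> nat \<Rightarrow> 'a mat set" where
  "Delta_blocks z \<delta> =
     (if \<delta> = 0 then {0\<^sub>m 0 0}
      else if \<delta> = 1 then {mat_of_rows_list 1 [[1]], mat_of_rows_list 1 [[z]]}
      else if \<delta> = 2 then {mat_of_rows_list 2 [[1, 0], [0, - z]]}
      else {})"

definition S_mat :: "nat \<Rightarrow> nat \<Rightarrow> 'a::field mat \<Rightarrow> 'a mat" where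
  "S_mat \<nu> \<delta> \<Delta> =
     four_block_mat
       (four_block_mat (0\<^sub>m \<nu> \<nu>) (1\<^sub>m \<nu>) (1\<^sub>m \<nu>) (0\<^sub>m \<nu> \<nu>)) (0\<^sub>m (2 * \<nu>) \<delta>)
       (0\<^sub>m \<delta> (2 * \<nu>)) \<Delta>"

text \<open>\<open>A\<close> is a matrix whose rows, listed without repetition, form a basis of the subspace \<open>U\<close>.\<close>

definition represents :: "nat \<Rightarrow> 'a::field mat \<Rightarrow> 'a vec set \<Rightarrow> bool" where
  "represents n A U \<longleftrightarrow>
     dim_col A = n \<and> distinct (rows A) \<and>
     \<not> LinearCombinations.module.lin_dep class_ring (module_vec TYPE('a) n) (set (rows A)) \<and>
     LinearCombinations.module.span class_ring (module_vec TYPE('a) n) (set (rows A)) = U"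

definition nontrivial_subspaces :: "nat \<Rightarrow> 'a::field vec set set" where
  "nontrivial_subspaces n =
     {U. VectorSpace.subspace class_ring U (module_vec TYPE('a) n) \<and>
         U \<noteq> {0\<^sub>v n} \<and> U \<noteq> carrier_vec n}"

definition oi_adjacent :: "nat \<Rightarrow> 'a::field mat \<Rightarrow> 'a vec set \<Rightarrow> 'a vec set \<Rightarrow> bool" where
  "oi_adjacent n S U W \<longleftrightarrow>
     (\<exists>A B. represents n A U \<and> represents n B W \<and>
            A * S * B\<^sup>T = 0\<^sub>m (dim_row A) (dim_row B))"

text \<open>
  The undirected graph is encoded as a symmetric digraph without parallel arcs, so the edge
  between \<open>U\<close> and \<open>W\<close> is the pair of arcs \<open>(U, W)\<close>, \<open>(W, U)\<close>, and a loop at \<open>U\<close> is the arc \<open>(U, U)\<close>.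
\<close>

definition Oi :: "nat \<Rightarrow> nat \<Rightarrow> 'a::field mat \<Rightarrow> 'a vec set pair_pre_digraph" where
  "Oi \<nu> \<delta> \<Delta> =
     \<lparr> pverts = nontrivial_subspaces (2 * \<nu> + \<delta>),
       parcs = {(U, W). U \<in> nontrivial_subspaces (2 * \<nu> + \<delta>) \<and>
                        W \<in> nontrivial_subspaces (2 * \<nu> + \<delta>) \<and>
                        oi_adjacent (2 * \<nu> + \<delta>) (S_mat \<nu> \<delta> \<Delta>) U W} \<rparr>"

text \<open>The choice of the representing matrices does not matter.\<close>

lemma represents_zero_iff:
  fixes S :: "'a::field mat"
  assumes S: "S \<in> carrier_mat n n" and A: "represents n A U" and B: "represents n B W"
  shows "A * S * B\<^sup>T = 0\<^sub>m (dim_row A) (dim_row B) \<longleftrightarrow> (\<forall>u\<in>U. \<forall>w\<in>W. u \<bullet> (S *\<^sub>v w) = 0)"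
proof -
  interpret vec_space "TYPE('a)" n .
  have Ac: "A \<in> carrier_mat (dim_row A) n" and Bc: "B \<in> carrier_mat (dim_row B) n"
    using A B by (auto simp: represents_def)
  have spanA: "span (set (rows A)) = U" and spanB: "span (set (rows B)) = W"
    using A B by (auto simp: represents_def)
  have RA: "set (rows A) \<subseteq> carrier_vec n" and RB: "set (rows B) \<subseteq> carrier_vec n"
    using rows_carrier[of A] rows_carrier[of B] Ac Bc by (metis carrier_matD(2))+
  have entry: "(A * S * B\<^sup>T) $$ (i, j) = row A i \<bullet> (S *\<^sub>v row B j)"
    if "i < dim_row A" "j < dim_row B" for i j
  proof -
    have "A * S * B\<^sup>T = A * (S * B\<^sup>T)"
      by (rule assoc_mult_mat[OF Ac S transpose_carrier_mat[THEN iffD2, OF Bc]])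
    moreover have "col (S * B\<^sup>T) j = S *\<^sub>v row B j"
      using that col_mult2[OF S transpose_carrier_mat[THEN iffD2, OF Bc]] by simp
    ultimately show ?thesis using that by simp
  qed
  have "A * S * B\<^sup>T = 0\<^sub>m (dim_row A) (dim_row B) \<longleftrightarrow>
        (\<forall>i<dim_row A. \<forall>j<dim_row B. row A i \<bullet> (S *\<^sub>v row B j) = 0)"
  proof
    assume eq: "A * S * B\<^sup>T = 0\<^sub>m (dim_row A) (dim_row B)"
    show "\<forall>i<dim_row A. \<forall>j<dim_row B. row A i \<bullet> (S *\<^sub>v row B j) = 0"
      using entry eq by (metis index_zero_mat(1))
  next
    assume "\<forall>i<dim_row A. \<forall>j<dim_row B. row A i \<bullet> (S *\<^sub>v row B j) = 0"
    then show "A * S * B\<^sup>T = 0\<^sub>m (dim_row A) (dim_row B)"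
      using entry by (intro eq_matI) auto
  qed
  also have "\<dots> \<longleftrightarrow> (\<forall>u\<in>set (rows A). \<forall>w\<in>set (rows B). u \<bullet> (S *\<^sub>v w) = 0)"
    by (auto simp: rows_def)
  also have "\<dots> \<longleftrightarrow> (\<forall>u\<in>U. \<forall>w\<in>W. u \<bullet> (S *\<^sub>v w) = 0)"
  proof
    assume "\<forall>u\<in>U. \<forall>w\<in>W. u \<bullet> (S *\<^sub>v w) = 0"
    then show "\<forall>u\<in>set (rows A). \<forall>w\<in>set (rows B). u \<bullet> (S *\<^sub>v w) = 0"
      using in_own_span[OF RA] in_own_span[OF RB] spanA spanB by blast
  next
    assume z: "\<forall>u\<in>set (rows A). \<forall>w\<in>set (rows B). u \<bullet> (S *\<^sub>v w) = 0"
    have subU: "U \<subseteq> {u \<in> carrier_vec n. u \<bullet> (S *\<^sub>v w) = 0}" if w: "w \<in> set (rows B)" for w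
    proof -
      have Sw: "S *\<^sub>v w \<in> carrier_vec n" using S by (intro carrier_vecI) simp
      have "submodule class_ring {u \<in> carrier_vec n. u \<bullet> (S *\<^sub>v w) = 0} V"
        using Sw by (intro submodule.intro module_axioms) (auto simp: add_scalar_prod_distrib[of _ n])
      then show ?thesis
        unfolding spanA[symmetric] using z w RA by (intro span_is_subset) auto
    qed
    show "\<forall>u\<in>U. \<forall>w\<in>W. u \<bullet> (S *\<^sub>v w) = 0"
    proof
      fix u assume u: "u \<in> U"
      have uc: "u \<in> carrier_vec n" using u span_is_subset2[OF RA] spanA by blast
      have S0: "S *\<^sub>v 0\<^sub>v n = 0\<^sub>v n" using S by (intro eq_vecI) auto
      have "submodule class_ring {w \<in> carrier_vec n. u \<bullet> (S *\<^sub>v w) = 0} V"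
        using S uc
        by (intro submodule.intro module_axioms)
          (auto simp: S0 mult_add_distrib_mat_vec[of _ n n] scalar_prod_add_distrib[of _ n]
            mult_mat_vec[of _ n n])
      then have "W \<subseteq> {w \<in> carrier_vec n. u \<bullet> (S *\<^sub>v w) = 0}"
        unfolding spanB[symmetric] using subU u RB by (intro span_is_subset) auto
      then show "\<forall>w\<in>W. u \<bullet> (S *\<^sub>v w) = 0" by auto
    qed
  qed
  finally show ?thesis .
qed

text \<open>Digraph isomorphism is the usual notion: a bijection that preserves adjacency both ways.\<close>

lemma digraph_iso_with_proj_iff:
  assumes "pair_wf_digraph G" "pair_wf_digraph H"
  shows "digraph_iso (with_proj G) (with_proj H) \<longleftrightarrow>
         (\<exists>f. bij_betw f (pverts G) (pverts H) \<and>
              (\<forall>u\<in>pverts G. \<forall>v\<in>pverts G. (u, v) \<in> parcs G \<longleftrightarrow> (f u, f v) \<in> parcs H))"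
proof
  assume "digraph_iso (with_proj G) (with_proj H)"
  then obtain h where h: "pre_digraph.digraph_isomorphism (with_proj G) h"
    and H: "with_proj H = app_iso h (with_proj G)"
    unfolding digraph_iso_def by blast
  have pv: "pverts H = iso_verts h ` pverts G" and pa: "parcs H = iso_arcs h ` parcs G"
    and t: "iso_tail h = fst" and hd: "iso_head h = snd"
    using arg_cong[OF H, of verts] arg_cong[OF H, of arcs]
      arg_cong[OF H, of tail] arg_cong[OF H, of head] by auto
  have inj: "inj_on (iso_verts h) (pverts G)"
    and ends: "\<And>a. a \<in> parcs G \<Longrightarrow> iso_arcs h a = (iso_verts h (fst a), iso_verts h (snd a))"
    using h unfolding pre_digraph.digraph_isomorphism_def by (auto simp: t hd prod_eq_iff)
  have "(u, v) \<in> parcs G \<longleftrightarrow> (iso_verts h u, iso_verts h v) \<in> parcs H"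
    if uv: "u \<in> pverts G" "v \<in> pverts G" for u v
  proof
    assume "(u, v) \<in> parcs G"
    then show "(iso_verts h u, iso_verts h v) \<in> parcs H"
      using ends[of "(u, v)"] by (auto simp: pa intro: rev_image_eqI)
  next
    assume "(iso_verts h u, iso_verts h v) \<in> parcs H"
    then obtain a where a: "a \<in> parcs G" "iso_arcs h a = (iso_verts h u, iso_verts h v)"
      by (auto simp: pa)
    then have "iso_verts h (fst a) = iso_verts h u" "iso_verts h (snd a) = iso_verts h v"
      using ends[OF a(1)] by auto
    then have "fst a = u" "snd a = v"
      using inj uv pair_wf_digraph.arc_fst_in_verts[OF assms(1) a(1)]
        pair_wf_digraph.arc_snd_in_verts[OF assms(1) a(1)] by (auto dest: inj_onD)
    then show "(u, v) \<in> parcs G" using a(1) by auto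
  qed
  then show "\<exists>f. bij_betw f (pverts G) (pverts H) \<and>
      (\<forall>u\<in>pverts G. \<forall>v\<in>pverts G. (u, v) \<in> parcs G \<longleftrightarrow> (f u, f v) \<in> parcs H)"
    using inj pv by (auto simp: bij_betw_def)
next
  assume "\<exists>f. bij_betw f (pverts G) (pverts H) \<and>
      (\<forall>u\<in>pverts G. \<forall>v\<in>pverts G. (u, v) \<in> parcs G \<longleftrightarrow> (f u, f v) \<in> parcs H)"
  then obtain f where inj: "inj_on f (pverts G)" and pv: "pverts H = f ` pverts G"
    and adj: "\<And>u v. u \<in> pverts G \<Longrightarrow> v \<in> pverts G \<Longrightarrow> (u, v) \<in> parcs G \<longleftrightarrow> (f u, f v) \<in> parcs H"
    by (auto simp: bij_betw_def)
  note wfG = pair_wf_digraph.in_arcsD1[OF assms(1)] pair_wf_digraph.in_arcsD2[OF assms(1)]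
  note wfH = pair_wf_digraph.in_arcsD1[OF assms(2)] pair_wf_digraph.in_arcsD2[OF assms(2)]
  define h where "h = \<lparr>iso_verts = f, iso_arcs = map_prod f f, iso_head = snd, iso_tail = fst\<rparr>"
  have "wf_digraph (with_proj G)"
    using wfG by (unfold_locales) auto
  moreover have "inj_on (map_prod f f) (parcs G)"
    using inj wfG by (auto simp: inj_on_def)
  ultimately have "pre_digraph.digraph_isomorphism (with_proj G) h"
    unfolding pre_digraph.digraph_isomorphism_def using inj by (auto simp: h_def)
  moreover have "parcs H = map_prod f f ` parcs G"
  proof (intro equalityI subsetI)
    fix e assume e: "e \<in> parcs H"
    then obtain x y where xy: "e = (x, y)" "x \<in> pverts H" "y \<in> pverts H"
      using wfH by (cases e) auto
    then obtain u v where "u \<in> pverts G" "v \<in> pverts G" "x = f u" "y = f v"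
      using pv by auto
    then show "e \<in> map_prod f f ` parcs G"
      using adj[of u v] e xy by (auto intro: rev_image_eqI)
  next
    fix e assume "e \<in> map_prod f f ` parcs G"
    then obtain u v where uv: "(u, v) \<in> parcs G" "e = (f u, f v)" by auto
    then show "e \<in> parcs H" using adj[of u v] wfG[of u v] by blast
  qed
  then have "with_proj H = app_iso h (with_proj G)"
    using pv by (auto simp: h_def with_proj_def app_iso_def)
  ultimately show "digraph_iso (with_proj G) (with_proj H)"
    unfolding digraph_iso_def by blast
qed

end

theory Submission
  imports Defs "HOL-Algebra.Multiplicative_Group" "HOL-Algebra.Sylow"
    "Berlekamp_Zassenhaus.Berlekamp_Type_Based"
begin

text \<open>
  Write \<open>n = 2 * \<nu> + \<delta>\<close> and \<open>q\<close> for the cardinality of the field, and let \<open>U\<^sup>\<bottom>\<close> denote the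
  subspace of all vectors that are orthogonal to \<open>U\<close> under the symmetric form with matrix \<open>S\<close>.

  Isomorphic graphs have equal parameters because \<open>q\<close>, \<open>n\<close> and \<open>\<nu>\<close> can all be read off the graph.
  The form is nondegenerate, so \<open>U \<mapsto> U\<^sup>\<bottom>\<close> is an involution on the vertices, and \<open>T \<subseteq> U\<close> holds
  exactly when every neighbour of \<open>U\<close> is a neighbour of \<open>T\<close>: one of the neighbours of \<open>U\<close> is
  \<open>U\<^sup>\<bottom>\<close> itself. Hence an isomorphism preserves inclusion and with it the minimal vertices, which
  are the lines. A subspace with \<open>a\<close> lines has \<open>a * (q - 1) + 1\<close> vectors. If the whole space has
  \<open>a\<close> lines, of which \<open>b\<close> are adjacent to a fixed line, then \<open>q ^ n = a * (q - 1) + 1\<close> and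
  \<open>q ^ (n - 1) = b * (q - 1) + 1\<close>, so that \<open>a = q * b + 1\<close> with \<open>b > 0\<close>. This determines \<open>q\<close>, then
  \<open>n\<close>, and then the cardinality of each vertex (\<open>orthogonality_graph_determines_cardinalities\<close>).
  The vertices with a loop are the totally isotropic ones. They have at most \<open>q ^ \<nu>\<close> vectors, and
  for \<open>\<nu> > 0\<close> one of them attains this bound (\<open>card_totally_isotropic_le\<close>,
  \<open>totally_isotropic_exists\<close>). This determines \<open>\<nu>\<close> and therefore \<open>\<delta> = n - 2 * \<nu>\<close>.

  All dimension arguments are replaced by counting; the central fact is
  \<open>card U * card U\<^sup>\<bottom> = q ^ n\<close>, obtained by counting orthogonal pairs in two ways (\<open>card_perp\<close>).

  Conversely, finite fields of the same cardinality are isomorphic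
  (\<open>finite_fields_isomorphic_if_card_eq\<close>). Applying a field isomorphism to the coordinates and
  rescaling them carries one form to a nonzero multiple of the other, because quotients of
  non-squares are squares (\<open>Delta_blocks_similar\<close>), and such a bijection induces a graph
  isomorphism (\<open>graph_iso_semilinear\<close>).
\<close>

section \<open>Finite fields of the same cardinality\<close>

lemma finite_field_generator:
  obtains g :: "'a::{field,finite}" where "\<And>x. x \<noteq> 0 \<Longrightarrow> \<exists>i::nat. x = g ^ i"
proof -
  let ?R = "class_ring :: 'a ring"
  obtain g where "g \<in> carrier (mult_of ?R)"
    and "carrier (mult_of ?R) = {g [^]\<^bsub>?R\<^esub> i | i::nat. i \<in> UNIV}"
    using Multiplicative_Group.field.finite_field_mult_group_has_gen[OF class_field[where 'a='a]] by auto
  then have all: "UNIV - {0} = {g ^ i | i::nat. True}"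
    by (simp_all add: carrier_mult_of class_ring_simps)
  show ?thesis
    by (rule that[of g]) (use all in blast)
qed

lemma finite_field_power_card:
  fixes x :: "'a::{field,finite}"
  shows "x ^ CARD('a) = x"
proof (cases "x = 0")
  case False
  let ?R = "class_ring :: 'a ring"
  have ord: "Coset.order (mult_of ?R) = CARD('a) - 1"
    by (simp add: Coset.order_def carrier_mult_of class_ring_simps)
  have "x [^]\<^bsub>mult_of ?R\<^esub> Coset.order (mult_of ?R) = \<one>\<^bsub>mult_of ?R\<^esub>"
    using False
    by (intro group.pow_order_eq_1[OF Multiplicative_Group.field.field_mult_group[OF class_field]]) (simp_all add: class_ring_simps)
  then have "x ^ (CARD('a) - 1) = 1"
    unfolding ord by (simp add: nat_pow_mult_of class_ring_simps)
  moreover have "CARD('a) = Suc (CARD('a) - 1)"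
    by simp
  ultimately show ?thesis
    by (metis mult.right_neutral power_Suc)
qed (simp add: zero_power)

text \<open>
  By Sylow's theorem the additive group has a subgroup of order \<open>r\<close>. A nonzero element of it is
  annihilated by \<open>r\<close>, and then \<open>r\<close> vanishes in the field. The lemma is the means to see that
  the cardinality determines the characteristic.
\<close>
lemma prime_dvd_card_finite_field:
  assumes "prime r" "r dvd CARD('a::{field,finite})"
  shows "r = CHAR('a)"
proof -
  let ?G = "add_monoid (class_ring :: 'a ring)"
  have ag: "group ?G"
    by (rule abelian_group.a_group[OF ring.is_abelian_group]) unfold_locales
  obtain m where m: "CARD('a) = r ^ 1 * m"
    using assms by auto
  obtain H where H: "subgroup H ?G" "card H = r"
    using sylow_thm[OF assms(1) ag, of 1 m] m by (auto simp: Coset.order_def)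
  have "H \<noteq> {0}" using H(2) assms(1) by (auto simp: prime_nat_iff)
  moreover have "0 \<in> H" using subgroup.one_closed[OF H(1)] by simp
  ultimately obtain x where x: "x \<in> H" "x \<noteq> 0" by blast
  interpret HG: group "?G\<lparr>carrier := H\<rparr>"
    by (rule group.subgroup_imp_group[OF ag H(1)])
  have pw: "x [^]\<^bsub>?G\<lparr>carrier := H\<rparr>\<^esub> k = of_nat k * x" for k :: nat
  proof (induction k)
    case (Suc k)
    then show ?case using HG.nat_pow_Suc[of x k] by (simp add: algebra_simps)
  qed simp
  have "x [^]\<^bsub>?G\<lparr>carrier := H\<rparr>\<^esub> Coset.order (?G\<lparr>carrier := H\<rparr>) = \<one>\<^bsub>?G\<lparr>carrier := H\<rparr>\<^esub>"
    using x by (intro HG.pow_order_eq_1) simp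
  then have "of_nat r * x = 0"
    unfolding pw by (simp add: Coset.order_def H(2))
  then have "(of_nat r :: 'a) = 0" using x by simp
  then have "CHAR('a) dvd r"
    by (simp add: of_nat_eq_0_iff_char_dvd)
  then show ?thesis using assms(1)
    by (metis CHAR_not_1' One_nat_def prime_nat_iff)
qed

lemma CHAR_eq_if_card_eq:
  assumes "CARD('a::{field,finite}) = CARD('b::{field,finite})"
  shows "CHAR('a) = CHAR('b)"
proof -
  have "prime CHAR('a)"
    by (rule prime_CHAR_semidom, rule finite_imp_CHAR_pos) simp
  then show ?thesis
    using prime_dvd_card_finite_field[where 'a='b, of "CHAR('a)"] CHAR_dvd_CARD[where 'a='a] assms by simp
qed

text \<open>
  Elements of two finite fields are compared through integer polynomials: these can be evaluated
  in both fields, whereas polynomials over a prime field would have coefficients of two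
  different types.
\<close>
definition int_poly_at :: "int poly \<Rightarrow> 'a::comm_ring_1 \<Rightarrow> 'a" where
  "int_poly_at p x = poly (map_poly of_int p) x"

lemma int_poly_at_simps [simp]:
  "int_poly_at (p + r) x = int_poly_at p x + int_poly_at r x"
  "int_poly_at (p - r) x = int_poly_at p x - int_poly_at r x"
  "int_poly_at (p * r) x = int_poly_at p x * int_poly_at r x"
  "int_poly_at (Polynomial.smult c p) x = of_int c * int_poly_at p x"
  "int_poly_at 0 x = 0"
  "int_poly_at 1 x = 1"
  "int_poly_at (Polynomial.monom c k) x = of_int c * x ^ k"
proof -
  interpret map_poly_comm_ring_hom "of_int :: int \<Rightarrow> 'a" ..
  show "int_poly_at (p + r) x = int_poly_at p x + int_poly_at r x"
    "int_poly_at (p - r) x = int_poly_at p x - int_poly_at r x"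
    "int_poly_at (p * r) x = int_poly_at p x * int_poly_at r x"
    "int_poly_at 0 x = 0" "int_poly_at 1 x = 1"
    by (simp_all add: int_poly_at_def hom_distribs)
  show "int_poly_at (Polynomial.smult c p) x = of_int c * int_poly_at p x"
    by (simp add: int_poly_at_def of_int_hom.map_poly_hom_smult)
  show "int_poly_at (Polynomial.monom c k) x = of_int c * x ^ k"
    by (simp add: int_poly_at_def map_poly_monom poly_monom)
qed

lemma int_poly_at_mod_CHAR:
  assumes "\<And>i. int CHAR('a::comm_ring_1) dvd coeff r i"
  shows "int_poly_at r (x :: 'a) = 0"
proof -
  have "map_poly of_int r = (0 :: 'a poly)"
    by (intro poly_eqI) (use assms in \<open>simp add: coeff_map_poly of_int_eq_0_iff_char_dvd\<close>)
  then show ?thesis by (simp add: int_poly_at_def)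
qed

text \<open>
  A monic integer polynomial of least degree that vanishes at \<open>g\<close> is a lift of the minimal
  polynomial of \<open>g\<close> over the prime field. Dividing \<open>f\<close> by it leaves a remainder \<open>r\<close> that also
  vanishes at \<open>g\<close>; if some coefficient of \<open>r\<close> were a unit modulo the characteristic, reducing
  and rescaling \<open>r\<close> would give a monic polynomial of smaller degree.
\<close>
lemma int_poly_killing_finite_field_element:
  fixes g :: "'a::{field,finite}"
  obtains p :: "int poly" where "lead_coeff p = 1" "int_poly_at p g = 0"
    "\<And>f. int_poly_at f g = 0 \<Longrightarrow>
       \<exists>s r. f = p * s + r \<and> (\<forall>i. int CHAR('a) dvd coeff r i)"
proof -
  let ?q = "CARD('a)" and ?l = "int CHAR('a)"
  have l: "prime ?l"
    using prime_CHAR_semidom[where 'a='a] finite_imp_CHAR_pos[where 'a='a] by simp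
  have q: "1 < ?q"
    using card_mono[of UNIV "{0, 1 :: 'a}"] by simp
  define P where "P = (\<lambda>p :: int poly. lead_coeff p = 1 \<and> int_poly_at p g = 0)"
  have "P (monom 1 ?q - monom 1 1)"
  proof -
    have "degree (monom 1 ?q - monom 1 1 :: int poly) = ?q"
      using q by (intro antisym degree_diff_le le_degree) (auto simp: degree_monom_eq)
    then show ?thesis
      using q finite_field_power_card[of g] by (simp add: P_def)
  qed
  then obtain p where p: "P p" and min: "\<And>p'. P p' \<Longrightarrow> degree p \<le> degree p'"
    using ex_has_least_nat[of P _ degree] by blast
  have p0: "p \<noteq> 0" using p by (auto simp: P_def)
  have small: "\<forall>i. ?l dvd coeff r i" if r: "int_poly_at r g = 0" "r = 0 \<or> degree r < degree p" for r
  proof (rule ccontr)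
    assume not: "\<not> (\<forall>i. ?l dvd coeff r i)"
    define r1 where "r1 = map_poly (\<lambda>c. c mod ?l) r"
    have c1: "coeff r1 i = coeff r i mod ?l" for i
      by (simp add: r1_def coeff_map_poly)
    have "r1 \<noteq> 0"
      using not c1 by (metis coeff_0 mod_0_imp_dvd)
    then have lc: "\<not> ?l dvd lead_coeff r1"
      by (metis c1 dvd_eq_mod_eq_0 leading_coeff_0_iff mod_mod_trivial)
    have deg1: "degree r1 < degree p"
    proof -
      have "r \<noteq> 0" using not by auto
      moreover have "degree r1 \<le> degree r"
        by (intro degree_le) (simp add: c1 coeff_eq_0)
      ultimately show ?thesis using r by simp
    qed
    have "int_poly_at (r - r1) g = 0"
      by (intro int_poly_at_mod_CHAR) (simp add: c1)
    then have r1: "int_poly_at r1 g = 0" using r by simp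
    have "algebraic_semidom_class.coprime (lead_coeff r1) ?l"
      using l lc Factorial_Ring.prime_imp_coprime[of ?l "lead_coeff r1"] by (simp add: ac_simps)
    then obtain d where "[lead_coeff r1 * d = 1] (mod ?l)"
      using cong_solve_coprime_int by blast
    then obtain k where k: "lead_coeff r1 * d = 1 + ?l * k"
      by (metis add.commute cong_iff_lin cong_sym mult.commute)
    \<comment> \<open>The leading coefficient of \<open>smult d r1\<close> is \<open>1 + ?l * k\<close>; removing its multiple of \<open>?l\<close>
    makes the polynomial monic and does not change its value at \<open>g\<close>.\<close>
    define r2 where "r2 = smult d r1 - monom (?l * k) (degree r1)"
    have c2: "coeff r2 (degree r1) = 1"
      using k by (simp add: r2_def algebra_simps)
    have "degree r2 \<le> degree r1"
      unfolding r2_def by (intro degree_diff_le) (simp_all add: degree_monom_le)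
    moreover have "degree r1 \<le> degree r2"
      using c2 by (intro le_degree) simp
    ultimately have d2: "degree r2 = degree r1" by simp
    have "int_poly_at r2 g = 0"
      using r1 by (simp add: r2_def)
    then have "P r2" using c2 d2 by (simp add: P_def)
    then show False using min[of r2] d2 deg1 by simp
  qed
  show thesis
  proof (rule that[of p])
    show "lead_coeff p = 1" "int_poly_at p g = 0" using p by (auto simp: P_def)
    fix f assume f: "int_poly_at f g = 0"
    obtain s r where sr: "pseudo_divmod f p = (s, r)" by force
    have eq: "f = p * s + r" and dr: "r = 0 \<or> degree r < degree p"
      using pseudo_divmod[OF p0 sr] p by (auto simp: P_def)
    have "int_poly_at r g = 0"
      using f p unfolding eq by (simp add: P_def)
    then have "\<forall>i. ?l dvd coeff r i" using small dr by blast
    then show "\<exists>s r. f = p * s + r \<and> (\<forall>i. ?l dvd coeff r i)"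
      using eq by blast
  qed
qed

text \<open>
  The lifted minimal polynomial \<open>p\<close> of \<open>g\<close> divides \<open>X ^ q - X\<close> modulo the characteristic. In the
  second field, every element is a root of \<open>X ^ q - X\<close>, while the cofactor of \<open>p\<close> has fewer than
  \<open>q\<close> roots. So \<open>p\<close> has a root \<open>h\<close> there.
\<close>
lemma element_with_same_int_polys:
  fixes g :: "'a::{field,finite}"
  assumes card: "CARD('a) = CARD('b::{field,finite})"
  obtains h :: "'b::{field,finite}" where "\<And>f. int_poly_at f g = 0 \<Longrightarrow> int_poly_at f h = 0"
proof -
  have char: "CHAR('a) = CHAR('b)" by (rule CHAR_eq_if_card_eq[OF card])
  let ?q = "CARD('a)"
  have q: "1 < ?q"
    using card_mono[of UNIV "{0, 1 :: 'a}"] by simp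
  obtain p :: "int poly" where p: "lead_coeff p = 1" "int_poly_at p g = 0"
    and div: "\<And>f. int_poly_at f g = 0 \<Longrightarrow>
       \<exists>s r. f = p * s + r \<and> (\<forall>i. int CHAR('a) dvd coeff r i)"
    using int_poly_killing_finite_field_element[of g] by metis
  have "\<exists>s r. monom 1 ?q - monom 1 1 = p * s + r \<and> (\<forall>i. int CHAR('a) dvd coeff r i)"
    using div[of "monom 1 ?q - monom 1 1"] finite_field_power_card[of g] by auto
  then obtain s r where eq: "monom 1 ?q - monom 1 1 = p * s + r"
    and r: "\<forall>i. int CHAR('a) dvd coeff r i" by blast
  interpret map_poly_comm_ring_hom "of_int :: int \<Rightarrow> 'b" ..
  let ?b = "map_poly of_int :: int poly \<Rightarrow> 'b poly"
  have "?b r = 0"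
    by (intro poly_eqI) (use r char in \<open>simp add: coeff_map_poly of_int_eq_0_iff_char_dvd\<close>)
  then have beq: "?b p * ?b s = monom 1 ?q - monom 1 1"
    using arg_cong[OF eq, of ?b] by (simp add: hom_distribs map_poly_monom)
  have deg: "degree (monom 1 ?q - monom 1 1 :: 'b poly) = ?q"
    using q by (intro antisym degree_diff_le le_degree) (auto simp: degree_monom_eq)
  have nz: "?b p \<noteq> 0" "?b s \<noteq> 0"
    using beq deg q by auto
  have "degree p \<noteq> 0"
  proof
    assume "degree p = 0"
    then have "p = 1" using p(1) by (metis degree_0_id one_pCons)
    then show False using p(2) by simp
  qed
  moreover have "degree (?b p) = degree p"
    using p(1) by (intro degree_map_poly) auto
  ultimately have "degree (?b s) < ?q"
    using arg_cong[OF beq, of degree] deg degree_mult_eq[OF nz] by simp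
  then have "card {x. poly (?b s) x = 0} < card (UNIV :: 'b set)"
    using card_poly_roots_bound[OF nz(2)] card by simp
  then obtain h where h: "poly (?b s) h \<noteq> 0"
    by (metis (mono_tags, lifting) UNIV_eq_I less_irrefl mem_Collect_eq)
  have "poly (?b p * ?b s) h = 0"
    unfolding beq using finite_field_power_card[of h] card by (simp add: poly_monom)
  then have ph: "int_poly_at p h = 0"
    using h by (simp add: int_poly_at_def)
  show thesis
  proof (rule that[of h])
    fix f assume "int_poly_at f g = 0"
    then obtain s r where "f = p * s + r" "\<forall>i. int CHAR('a) dvd coeff r i"
      using div by blast
    then show "int_poly_at f h = 0"
      using ph char int_poly_at_mod_CHAR[of r h] by simp
  qed
qed

text \<open>
  Every element of the first field is the value of an integer polynomial at a generator \<open>g\<close> of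
  the multiplicative group. Sending \<open>f(g)\<close> to \<open>f(h0)\<close>, where \<open>h0\<close> is annihilated by all the
  polynomials that annihilate \<open>g\<close>, is therefore a well-defined ring homomorphism.
\<close>
theorem finite_fields_isomorphic_if_card_eq:
  assumes card: "CARD('a::{field,finite}) = CARD('b::{field,finite})"
  obtains h :: "'a::{field,finite} \<Rightarrow> 'b::{field,finite}" where "bij h" "\<And>x y. h (x + y) = h x + h y" "\<And>x y. h (x * y) = h x * h y"
proof -
  obtain g :: 'a where g: "\<And>x. x \<noteq> 0 \<Longrightarrow> \<exists>i::nat. x = g ^ i"
    using finite_field_generator by blast
  obtain h0 :: 'b where h0: "\<And>f. int_poly_at f g = 0 \<Longrightarrow> int_poly_at f h0 = 0"
    using element_with_same_int_polys[OF card] by blast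
  have "\<exists>f. int_poly_at f g = x" for x
  proof (cases "x = 0")
    case False
    then obtain i where "x = g ^ i" using g by blast
    then have "int_poly_at (monom 1 i) g = x" by simp
    then show ?thesis by blast
  qed (metis int_poly_at_simps(5))
  then obtain F where F: "\<And>x. int_poly_at (F x) g = x" by metis
  define h where "h = (\<lambda>x. int_poly_at (F x) h0)"
  have h: "h (int_poly_at f g) = int_poly_at f h0" for f
    using h0[of "F (int_poly_at f g) - f"] F by (simp add: h_def)
  have add: "h (x + y) = h x + h y" for x y
    using h[of "F x + F y"] by (simp add: F) (simp add: h_def)
  have mult: "h (x * y) = h x * h y" for x y
    using h[of "F x * F y"] by (simp add: F) (simp add: h_def)
  have one: "h 1 = 1" using h[of 1] by simp
  have zero: "h 0 = 0" using h[of 0] by simp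
  have "inj h"
  proof (rule injI)
    fix x y assume "h x = h y"
    then have d: "h (x - y) = 0"
      using add[of "x - y" y] by simp
    show "x = y"
    proof (rule ccontr)
      assume "x \<noteq> y"
      then have "h 1 = h (x - y) * h (inverse (x - y))"
        unfolding mult[symmetric] by simp
      then show False using d one by simp
    qed
  qed
  moreover from this have "range h = UNIV"
    using card by (intro card_subset_eq) (auto simp: card_image)
  ultimately have "bij h" by (simp add: bij_def)
  then show thesis using add mult that by blast
qed

text \<open>
  Non-squares are the odd powers of a generator of the multiplicative group.
\<close>
lemma quotient_of_non_squares_is_square:
  fixes a b :: "'a::{field,finite}"
  assumes "\<nexists>x. a = x\<^sup>2" "\<nexists>x. b = x\<^sup>2"
  shows "\<exists>t. t \<noteq> 0 \<and> a = t\<^sup>2 * b"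
proof -
  obtain g :: 'a where g: "\<And>x. x \<noteq> 0 \<Longrightarrow> \<exists>i::nat. x = g ^ i"
    using finite_field_generator by blast
  have odd: "\<exists>i. c = g * (g ^ i)\<^sup>2" if "\<nexists>x. c = x\<^sup>2" for c
  proof -
    have "c \<noteq> 0" using that by (metis zero_power2)
    then obtain k where k: "c = g ^ k" using g by blast
    have "odd k"
    proof
      assume "even k"
      then obtain i where "k = 2 * i" by auto
      then have "c = (g ^ i)\<^sup>2" using k by (simp add: power_mult [symmetric] mult.commute)
      then show False using that by blast
    qed
    then obtain i where "k = 2 * i + 1" by (auto elim: oddE)
    then have "c = g * (g ^ i)\<^sup>2" using k by (simp add: power_mult [symmetric] mult.commute)
    then show ?thesis by blast
  qed
  obtain i where i: "a = g * (g ^ i)\<^sup>2" using odd[OF assms(1)] by blast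
  obtain j where j: "b = g * (g ^ j)\<^sup>2" using odd[OF assms(2)] by blast
  have "a \<noteq> 0" "b \<noteq> 0" using assms by (metis zero_power2)+
  then have "g \<noteq> 0" using i by auto
  then have "a = (g ^ i / g ^ j)\<^sup>2 * b" "g ^ i / g ^ j \<noteq> 0"
    unfolding i j by (simp_all add: power_divide)
  then show ?thesis by blast
qed

section \<open>Subspaces and the matrices that represent them\<close>

lemma card_eq_card_image_times_fibre:
  assumes "finite A" and fib: "\<And>x. x \<in> A \<Longrightarrow> card {y \<in> A. f y = f x} = k"
  shows "card A = card (f ` A) * k"
proof -
  have "card A = (\<Sum>y\<in>f ` A. card {x \<in> A. f x = y})"
    using sum.image_gen[OF assms(1), of "\<lambda>_. 1 :: nat" f] by simp
  also have "\<dots> = (\<Sum>y\<in>f ` A. k)"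
    using fib by (intro sum.cong) auto
  finally show ?thesis by simp
qed

text \<open>
  An elementary form of the locale predicate for subspaces
  (\<open>subspace_iff_vec_subspace\<close>), free of the record operations of the module structure.
\<close>
definition vec_subspace :: "nat \<Rightarrow> 'a::field vec set \<Rightarrow> bool" where
  "vec_subspace n U \<longleftrightarrow> U \<subseteq> carrier_vec n \<and> 0\<^sub>v n \<in> U \<and>
     (\<forall>u\<in>U. \<forall>w\<in>U. u + w \<in> U) \<and> (\<forall>c. \<forall>u\<in>U. c \<cdot>\<^sub>v u \<in> U)"

lemma vec_subspace_carrier: "vec_subspace n U \<Longrightarrow> u \<in> U \<Longrightarrow> u \<in> carrier_vec n"
  and vec_subspace_zero: "vec_subspace n U \<Longrightarrow> 0\<^sub>v n \<in> U"
  and vec_subspace_add: "vec_subspace n U \<Longrightarrow> u \<in> U \<Longrightarrow> w \<in> U \<Longrightarrow> u + w \<in> U"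
  and vec_subspace_smult: "vec_subspace n U \<Longrightarrow> u \<in> U \<Longrightarrow> c \<cdot>\<^sub>v u \<in> U"
  by (auto simp: vec_subspace_def)

lemma vec_subspace_diff:
  assumes U: "vec_subspace n U" "u \<in> U" "w \<in> U"
  shows "u - w \<in> U"
proof -
  have "u - w = u + (-1) \<cdot>\<^sub>v w"
    using assms vec_subspace_carrier[OF U(1)] by (intro eq_vecI) auto
  then show ?thesis
    using assms by (auto intro!: vec_subspace_add vec_subspace_smult)
qed

lemma vec_subspace_carrier_vec: "vec_subspace n (carrier_vec n)"
  by (auto simp: vec_subspace_def)

lemma vec_subspace_finite: "vec_subspace n U \<Longrightarrow> finite (U :: 'a::{field,finite} vec set)"
  unfolding vec_subspace_def by (metis finite_carrier_vec finite_subset)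

lemma subspace_iff_vec_subspace:
  "VectorSpace.subspace class_ring U (module_vec TYPE('a::field) n) \<longleftrightarrow> vec_subspace n U"
proof -
  interpret vec_space "TYPE('a)" n .
  show ?thesis
  proof
    assume "VectorSpace.subspace class_ring U V"
    then have "submodule class_ring U V" by (simp add: VectorSpace.subspace_def)
    then interpret submodule class_ring U V .
    show "vec_subspace n U"
      using subset m_closed zero_closed smult_closed
      by (auto simp: vec_subspace_def module_vec_simps class_ring_simps)
  next
    assume "vec_subspace n U"
    then have "submodule class_ring U V"
      by (intro submodule.intro module_axioms)
        (auto simp: vec_subspace_def module_vec_simps class_ring_simps)
    then show "VectorSpace.subspace class_ring U V"
      by (intro VectorSpace.subspace.intro vectorspace_axioms)
  qed
qed

text \<open>
  A linearly independent subset of \<open>U\<close> of largest cardinality spans \<open>U\<close>; its elements are the rows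
  of the required matrix.
\<close>
lemma vec_subspace_represented:
  assumes U: "vec_subspace n (U :: 'a::{field,finite} vec set)"
  shows "\<exists>A. represents n A U"
proof -
  interpret vec_space "TYPE('a)" n .
  let ?I = "{B. B \<subseteq> U \<and> \<not> lin_dep B}"
  have finU: "finite U" by (rule vec_subspace_finite[OF U])
  have "{} \<in> ?I" by (simp add: lin_dep_def)
  moreover have "\<forall>B. B \<in> ?I \<longrightarrow> card B < Suc (card U)"
    using card_mono[OF finU] by (simp add: less_Suc_eq_le)
  ultimately have "\<exists>B. B \<in> ?I \<and> (\<forall>B'. B' \<in> ?I \<longrightarrow> card B' \<le> card B)"
    by (rule ex_has_greatest_nat[where P = "\<lambda>B. B \<in> ?I" and f = card and b = "Suc (card U)"])
  then obtain B where B: "B \<in> ?I" and max: "\<And>B'. B' \<in> ?I \<Longrightarrow> card B' \<le> card B"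
    by (elim exE conjE) (erule that, erule allE, erule mp)
  have BU: "B \<subseteq> U" and indpt: "\<not> lin_dep B" using B by auto
  have BC: "B \<subseteq> carrier_vec n" using BU U by (auto simp: vec_subspace_def)
  have finB: "finite B" using BU finU by (rule finite_subset)
  have "span B \<subseteq> U"
    using U subspace_iff_vec_subspace[of U n] BU span_is_subset
    by (simp add: VectorSpace.subspace_def)
  moreover have "U \<subseteq> span B"
  proof
    fix u assume u: "u \<in> U"
    show "u \<in> span B"
    proof (rule ccontr)
      assume nin: "u \<notin> span B"
      then have nB: "u \<notin> B" using in_own_span[OF BC] by blast
      have uC: "u \<in> carrier_vec n" using u U by (auto simp: vec_subspace_def)
      have "\<not> lin_dep (insert u B)"
        using lin_dep_iff_in_span[OF _ indpt _ nB] BC uC nin by simp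
      then have "insert u B \<in> ?I" using u BU by simp
      then have "card (insert u B) \<le> card B" by (rule max)
      then show False using nB finB by simp
    qed
  qed
  ultimately have span: "span B = U" by blast
  obtain bs where bs: "set bs = B" "distinct bs"
    using finite_distinct_list[OF finB] by blast
  have "rows (mat_of_rows n bs) = bs"
    using bs BC by (intro rows_mat_of_rows) simp
  then have "represents n (mat_of_rows n bs) U"
    using bs indpt span by (simp add: represents_def)
  then show ?thesis ..
qed

lemma oi_adjacent_iff:
  fixes S :: "'a::{field,finite} mat"
  assumes "S \<in> carrier_mat n n" "vec_subspace n U" "vec_subspace n W"
  shows "oi_adjacent n S U W \<longleftrightarrow> (\<forall>u\<in>U. \<forall>w\<in>W. u \<bullet> (S *\<^sub>v w) = 0)"
proof -
  obtain A B where "represents n A U" "represents n B W"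
    using vec_subspace_represented assms(2,3) by blast
  then show ?thesis
    using represents_zero_iff[OF assms(1)] unfolding oi_adjacent_def by blast
qed

text \<open>
  The fibres of a homomorphism are translates of its kernel. Being a homomorphism is expressed by
  the hypothesis \<open>hom\<close>, which does not refer to any operation on the codomain: vectors of a fixed
  length form no type, so a projection to shorter vectors could not be called additive by a class
  constraint.
\<close>
lemma card_eq_image_times_kernel:
  fixes U :: "'a::{field,finite} vec set"
  assumes U: "vec_subspace n U"
    and hom: "\<And>u v. u \<in> U \<Longrightarrow> v \<in> U \<Longrightarrow> \<pi> u = \<pi> v \<longleftrightarrow> \<pi> (u - v) = \<pi> (0\<^sub>v n)"
  shows "card U = card (\<pi> ` U) * card {u \<in> U. \<pi> u = \<pi> (0\<^sub>v n)}"
proof (rule card_eq_card_image_times_fibre)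
  show "finite U" by (rule vec_subspace_finite[OF U])
next
  fix x assume x: "x \<in> U"
  let ?K = "{u \<in> U. \<pi> u = \<pi> (0\<^sub>v n)}"
  have C: "u \<in> carrier_vec n" if "u \<in> U" for u
    using that U by (auto simp: vec_subspace_def)
  have "bij_betw (\<lambda>u. u - x) {y \<in> U. \<pi> y = \<pi> x} ?K"
  proof (rule bij_betw_byWitness[where f' = "\<lambda>k. k + x"])
    have canc: "a - x + x = a" "a + x - x = a" if "a \<in> U" for a
      using C[OF that] C[OF x] by (intro eq_vecI; simp)+
    show "\<forall>a\<in>{y \<in> U. \<pi> y = \<pi> x}. a - x + x = a"
      using canc by simp
    show kx: "\<forall>a\<in>?K. a + x - x = a"
      using canc by simp
    show "(\<lambda>u. u - x) ` {y \<in> U. \<pi> y = \<pi> x} \<subseteq> ?K"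
      using hom[OF _ x] vec_subspace_diff[OF U _ x] by blast
    show "(\<lambda>k. k + x) ` ?K \<subseteq> {y \<in> U. \<pi> y = \<pi> x}"
    proof (clarify, intro conjI)
      fix k assume k: "k \<in> U" "\<pi> k = \<pi> (0\<^sub>v n)"
      show "k + x \<in> U" using k x U by (auto intro: vec_subspace_add)
      then show "\<pi> (k + x) = \<pi> x" using hom[of "k + x" x] k x kx by simp
    qed
  qed
  then show "card {y \<in> U. \<pi> y = \<pi> x} = card ?K"
    by (rule bij_betw_same_card)
qed

lemma card_kernel_functional:
  fixes U :: "'a::{field,finite} vec set"
  assumes U: "vec_subspace n U"
    and add: "\<And>u v. u \<in> U \<Longrightarrow> v \<in> U \<Longrightarrow> \<phi> (u + v) = \<phi> u + \<phi> v"
    and smult: "\<And>c u. u \<in> U \<Longrightarrow> \<phi> (c \<cdot>\<^sub>v u) = c * \<phi> u"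
    and nz: "u0 \<in> U" "\<phi> u0 \<noteq> (0 :: 'a)"
  shows "CARD('a) * card {u \<in> U. \<phi> u = 0} = card U"
proof -
  have "0 \<cdot>\<^sub>v u0 = 0\<^sub>v n" using vec_subspace_carrier[OF U nz(1)] by (intro eq_vecI) simp_all
  then have zero: "\<phi> (0\<^sub>v n) = 0" using smult[OF nz(1), of 0] by simp
  have "\<phi> ` U = UNIV"
  proof (intro equalityI subsetI UNIV_I)
    fix c
    have "\<phi> ((c / \<phi> u0) \<cdot>\<^sub>v u0) = c" using smult nz by simp
    then show "c \<in> \<phi> ` U"
      using U nz by (metis imageI vec_subspace_smult)
  qed
  moreover have "card U = card (\<phi> ` U) * card {u \<in> U. \<phi> u = \<phi> (0\<^sub>v n)}"
  proof (rule card_eq_image_times_kernel[OF U])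
    fix u v assume uv: "u \<in> U" "v \<in> U"
    have "u = (u - v) + v"
      using uv[THEN vec_subspace_carrier[OF U]] by (intro eq_vecI) simp_all
    then have "\<phi> u = \<phi> (u - v) + \<phi> v"
      using add[OF vec_subspace_diff[OF U uv] uv(2)] by simp
    then show "\<phi> u = \<phi> v \<longleftrightarrow> \<phi> (u - v) = \<phi> (0\<^sub>v n)" using zero by simp
  qed
  ultimately show ?thesis using zero by simp
qed

lemma one_less_card_field: "1 < CARD('a::{field,finite})"
  using card_mono[of UNIV "{0, 1 :: 'a}"] by simp


section \<open>Orthogonal complements by counting\<close>

definition orth :: "('a vec \<Rightarrow> 'a vec \<Rightarrow> 'a::zero) \<Rightarrow> 'a vec set \<Rightarrow> 'a vec set \<Rightarrow> bool" where
  "orth B U W \<longleftrightarrow> (\<forall>u\<in>U. \<forall>w\<in>W. B u w = 0)"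

definition perp :: "nat \<Rightarrow> ('a vec \<Rightarrow> 'a vec \<Rightarrow> 'a::zero) \<Rightarrow> 'a vec set \<Rightarrow> 'a vec set" where
  "perp n B U = {w \<in> carrier_vec n. \<forall>u\<in>U. B u w = 0}"

lemma smult_zero_vec_zero: "c \<cdot>\<^sub>v 0\<^sub>v n = (0\<^sub>v n :: 'a::semiring_1 vec)"
  by (intro eq_vecI) simp_all


locale nondegenerate_symmetric_form =
  fixes n :: nat and B :: "'a::{field,finite} vec \<Rightarrow> 'a vec \<Rightarrow> 'a"
  assumes add_left: "\<And>u v w. u \<in> carrier_vec n \<Longrightarrow> v \<in> carrier_vec n \<Longrightarrow> w \<in> carrier_vec n \<Longrightarrow>
      B (u + v) w = B u w + B v w"
    and smult_left: "\<And>c u w. u \<in> carrier_vec n \<Longrightarrow> w \<in> carrier_vec n \<Longrightarrow> B (c \<cdot>\<^sub>v u) w = c * B u w"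
    and sym: "\<And>u w. u \<in> carrier_vec n \<Longrightarrow> w \<in> carrier_vec n \<Longrightarrow> B u w = B w u"
    and nondegenerate: "\<And>u. u \<in> carrier_vec n \<Longrightarrow> (\<And>w. w \<in> carrier_vec n \<Longrightarrow> B u w = 0) \<Longrightarrow> u = 0\<^sub>v n"
begin

lemma zero_left: "w \<in> carrier_vec n \<Longrightarrow> B (0\<^sub>v n) w = 0"
  using smult_left[of "0\<^sub>v n" w 0] by (simp add: smult_zero_vec_zero)

lemma add_right: "u \<in> carrier_vec n \<Longrightarrow> v \<in> carrier_vec n \<Longrightarrow> w \<in> carrier_vec n \<Longrightarrow>
    B u (v + w) = B u v + B u w"
  using add_left[of v w u] sym by simp

lemma smult_right: "u \<in> carrier_vec n \<Longrightarrow> w \<in> carrier_vec n \<Longrightarrow> B u (c \<cdot>\<^sub>v w) = c * B u w"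
  using smult_left[of w u c] sym by simp

lemma vec_subspace_perp:
  assumes "U \<subseteq> carrier_vec n"
  shows "vec_subspace n (perp n B U)"
proof -
  have "B u (0\<^sub>v n) = 0" if "u \<in> U" for u
    using smult_right[of u "0\<^sub>v n" 0] that assms by (auto simp: smult_zero_vec_zero)
  then show ?thesis
    using assms by (auto simp: vec_subspace_def perp_def add_right smult_right subset_iff)
qed

text \<open>
  The pairs of \<open>u\<close> in \<open>U\<close> and \<open>w\<close> in the whole space with \<open>B u w = 0\<close> are counted in two ways. A
  functional that does not vanish identically on a space has a kernel of \<open>1 / q\<close> of its size
  (\<open>card_kernel_functional\<close>). For fixed \<open>u\<close> the functional vanishes on the whole space only if
  \<open>u = 0\<close>; for fixed \<open>w\<close> it vanishes on \<open>U\<close> only if \<open>w\<close> lies in \<open>perp n B U\<close>. With \<open>q = k + 1\<close>, and both counts multiplied by \<open>q\<close>, the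
  equation reduces to \<open>k * q ^ n = k * (card U * card (perp n B U))\<close>.
\<close>
lemma card_perp:
  assumes U: "vec_subspace n U"
  shows "card U * card (perp n B U) = CARD('a) ^ n"
proof -
  let ?C = "carrier_vec n :: 'a vec set"
  define k where "k = CARD('a) - 1"
  have q: "CARD('a) = Suc k" and k: "k \<noteq> 0"
    using one_less_card_field[where 'a='a] by (simp_all add: k_def)
  have finU: "finite U" by (rule vec_subspace_finite[OF U])
  have UC: "u \<in> ?C" if "u \<in> U" for u using U that by (rule vec_subspace_carrier)
  have pC: "perp n B U \<subseteq> ?C" by (auto simp: perp_def)
  have rows: "Suc k * card {w \<in> ?C. B u w = 0} = card ?C + (if u = 0\<^sub>v n then k * card ?C else 0)"
    if u: "u \<in> U" for u
  proof (cases "u = 0\<^sub>v n")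
    case True
    then have "{w \<in> ?C. B u w = 0} = ?C" using zero_left by auto
    then show ?thesis using True by simp
  next
    case False
    then obtain w where "w \<in> ?C" "B u w \<noteq> 0"
      using nondegenerate[OF UC[OF u]] by blast
    then show ?thesis
      using card_kernel_functional[OF vec_subspace_carrier_vec, of n "B u" w] False UC[OF u]
      by (simp add: add_right smult_right q)
  qed
  have cols: "Suc k * card {u \<in> U. B u w = 0} = card U + (if w \<in> perp n B U then k * card U else 0)"
    if w: "w \<in> ?C" for w
  proof (cases "w \<in> perp n B U")
    case True
    then have "{u \<in> U. B u w = 0} = U" by (auto simp: perp_def)
    then show ?thesis using True by simp
  next
    case False
    then obtain u where "u \<in> U" "B u w \<noteq> 0"
      using w by (auto simp: perp_def)
    then show ?thesis
      using card_kernel_functional[OF U, of "\<lambda>u. B u w" u] False UC w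
      by (simp add: add_left smult_left q)
  qed
  have c1: "card {w \<in> ?C. B u w = 0} = (\<Sum>w\<in>?C. of_bool (B u w = 0))" for u
    by (simp add: of_bool_def sum.If_cases Int_def)
  have c2: "card {u \<in> U. B u w = 0} = (\<Sum>u\<in>U. of_bool (B u w = 0))" for w
    using finU by (simp add: of_bool_def sum.If_cases Int_def)
  have "card U * card ?C + k * card ?C =
      (\<Sum>u\<in>U. card ?C + (if u = 0\<^sub>v n then k * card ?C else 0))"
    using finU vec_subspace_zero[OF U] by (simp add: sum.distrib)
  also have "\<dots> = (\<Sum>u\<in>U. Suc k * (\<Sum>w\<in>?C. of_bool (B u w = 0)))"
    by (intro sum.cong refl) (simp only: rows c1[symmetric])
  also have "\<dots> = (\<Sum>w\<in>?C. Suc k * (\<Sum>u\<in>U. of_bool (B u w = 0)))"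
    unfolding sum_distrib_left[symmetric] by (subst sum.swap) (rule refl)
  also have "\<dots> = (\<Sum>w\<in>?C. card U + (if w \<in> perp n B U then k * card U else 0))"
    by (intro sum.cong refl) (simp only: cols c2[symmetric])
  also have "\<dots> = card ?C * card U + card (perp n B U) * (k * card U)"
    using pC by (simp add: sum.distrib sum.If_cases Int_absorb1)
  finally have "k * card ?C = k * (card U * card (perp n B U))"
    by (simp add: algebra_simps)
  then show ?thesis using k by (simp add: card_carrier_vec)
qed

text \<open>
  One inclusion is the symmetry of the form; the cardinalities agree by \<open>card_perp\<close>.
\<close>
lemma perp_perp:
  assumes U: "vec_subspace n U"
  shows "perp n B (perp n B U) = U"
proof -
  have UC: "U \<subseteq> carrier_vec n" using U by (simp add: vec_subspace_def)
  have P: "vec_subspace n (perp n B U)" by (rule vec_subspace_perp[OF UC])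
  have "U \<subseteq> perp n B (perp n B U)"
    using UC sym by (auto simp: perp_def subset_iff)
  moreover have "card U = card (perp n B (perp n B U))"
  proof -
    have "card (perp n B U) \<noteq> 0"
      using vec_subspace_zero[OF P] vec_subspace_finite[OF P] by auto
    then show ?thesis
      using card_perp[OF U] card_perp[OF P] by (metis mult.commute mult_cancel_left)
  qed
  moreover have "finite (perp n B (perp n B U))"
    by (rule finite_subset[of _ "carrier_vec n"]) (auto simp: perp_def)
  ultimately show ?thesis by (metis card_subset_eq)
qed

end

section \<open>Lines\<close>

lemma nontrivial_subspaces_iff:
  "U \<in> nontrivial_subspaces n \<longleftrightarrow> vec_subspace n U \<and> U \<noteq> {0\<^sub>v n} \<and> U \<noteq> carrier_vec n"
  by (simp add: nontrivial_subspaces_def subspace_iff_vec_subspace)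

definition line :: "'a::field vec \<Rightarrow> 'a vec set" where
  "line v = range (\<lambda>c. c \<cdot>\<^sub>v v)"

definition lines :: "nat \<Rightarrow> 'a::field vec set \<Rightarrow> 'a vec set set" where
  "lines n U = line ` (U - {0\<^sub>v n})"

lemma vec_subspace_line:
  assumes "v \<in> carrier_vec n"
  shows "vec_subspace n (line v)"
proof -
  have "0\<^sub>v n = 0 \<cdot>\<^sub>v v" using assms by (intro eq_vecI) simp_all
  moreover have "c \<cdot>\<^sub>v v + d \<cdot>\<^sub>v v = (c + d) \<cdot>\<^sub>v v" for c d
    by (simp add: add_smult_distrib_vec)
  ultimately show ?thesis
    using assms by (auto simp: vec_subspace_def line_def smult_smult_assoc)
qed

lemma vec_in_line: "v \<in> line v"
proof -
  have "v = 1 \<cdot>\<^sub>v v" by simp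
  then show ?thesis unfolding line_def by (rule range_eqI)
qed

lemma card_line:
  fixes v :: "'a::{field,finite} vec"
  assumes "v \<in> carrier_vec n" "v \<noteq> 0\<^sub>v n"
  shows "card (line v) = CARD('a)"
proof -
  obtain i where i: "i < n" "v $ i \<noteq> 0"
    using assms by (metis carrier_vecD eq_vecI index_zero_vec(1) index_zero_vec(2))
  have "inj (\<lambda>c. c \<cdot>\<^sub>v v)"
  proof (rule injI)
    fix c d assume "c \<cdot>\<^sub>v v = d \<cdot>\<^sub>v v"
    then have "(c \<cdot>\<^sub>v v) $ i = (d \<cdot>\<^sub>v v) $ i" by simp
    then show "c = d" using i assms(1) by simp
  qed
  then show ?thesis by (simp add: line_def card_image)
qed

lemma line_eq_if_mem:
  assumes v: "v \<in> carrier_vec n" and w: "w \<in> line v" "w \<noteq> 0\<^sub>v n"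
  shows "line w = line v"
proof -
  obtain c where c: "w = c \<cdot>\<^sub>v v" using w(1) by (auto simp: line_def)
  have "c \<noteq> 0"
  proof
    assume "c = 0"
    then have "w = 0\<^sub>v n" unfolding c using v by (intro eq_vecI) simp_all
    then show False using w(2) by simp
  qed
  then have "d \<cdot>\<^sub>v v = (d / c) \<cdot>\<^sub>v w" for d
    unfolding c by (simp add: smult_smult_assoc)
  then have "line v \<subseteq> line w" by (auto simp: line_def)
  moreover have "line w \<subseteq> line v" by (auto simp: line_def c smult_smult_assoc)
  ultimately show ?thesis by blast
qed

lemma line_subset:
  assumes "vec_subspace n U" "v \<in> U"
  shows "line v \<subseteq> U"
  using assms by (auto simp: line_def intro: vec_subspace_smult)

lemma lines_subset_iff:
  assumes U: "vec_subspace n U"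
  shows "lines n U = {L \<in> lines n (carrier_vec n). L \<subseteq> U}"
  using line_subset[OF U] vec_in_line vec_subspace_carrier[OF U]
  by (fastforce simp: lines_def)

text \<open>
  The nonzero vectors of \<open>U\<close> are partitioned by the lines of \<open>U\<close> into classes of size \<open>q - 1\<close>.
\<close>
lemma card_lines:
  fixes U :: "'a::{field,finite} vec set"
  assumes U: "vec_subspace n U"
  shows "card U = card (lines n U) * (CARD('a) - 1) + 1"
proof -
  have fin: "finite U" by (rule vec_subspace_finite[OF U])
  have "card (U - {0\<^sub>v n}) = card (line ` (U - {0\<^sub>v n})) * (CARD('a) - 1)"
  proof (rule card_eq_card_image_times_fibre)
    fix x assume x: "x \<in> U - {0\<^sub>v n}"
    have xC: "x \<in> carrier_vec n" using x U by (auto simp: vec_subspace_def)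
    have "{y \<in> U - {0\<^sub>v n}. line y = line x} = line x - {0\<^sub>v n}"
      using line_eq_if_mem[OF xC] line_subset[OF U, of x] x vec_in_line by blast
    moreover have "0\<^sub>v n \<in> line x"
      using vec_subspace_line[OF xC] by (rule vec_subspace_zero)
    moreover have "finite (line x)" by (simp add: line_def)
    ultimately show "card {y \<in> U - {0\<^sub>v n}. line y = line x} = CARD('a) - 1"
      using card_line[OF xC] x by simp
  qed (use fin in simp)
  moreover have "card U = Suc (card (U - {0\<^sub>v n}))"
    using fin vec_subspace_zero[OF U] by (metis card_Suc_Diff1)
  ultimately show ?thesis by (simp add: lines_def)
qed

text \<open>
  The bound on \<open>n\<close> makes a line different from the whole space, so that it is a vertex at all.
\<close>
lemma minimal_nontrivial_subspaces:
  assumes n: "n \<ge> 2"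
  shows "{U \<in> nontrivial_subspaces n. \<forall>T\<in>nontrivial_subspaces n. T \<subseteq> U \<longrightarrow> T = U} =
    lines n (carrier_vec n :: 'a::{field,finite} vec set)" (is "?M = _")
proof -
  have line: "line v \<in> nontrivial_subspaces n" if v: "v \<in> carrier_vec n" "v \<noteq> 0\<^sub>v n" for v :: "'a vec"
  proof -
    have "CARD('a) ^ 1 < CARD('a) ^ n"
      using n one_less_card_field[where 'a='a] by (intro power_strict_increasing) auto
    then have "line v \<noteq> carrier_vec n"
      using card_line[OF v] by (metis card_carrier_vec less_irrefl power_one_right)
    moreover have "line v \<noteq> {0\<^sub>v n}" using vec_in_line[of v] v by auto
    ultimately show ?thesis
      using vec_subspace_line[OF v(1)] by (simp add: nontrivial_subspaces_iff)
  qed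
  have nz: "\<exists>v\<in>U. v \<in> carrier_vec n \<and> v \<noteq> 0\<^sub>v n" if "U \<in> nontrivial_subspaces n" for U :: "'a vec set"
  proof -
    have "0\<^sub>v n \<in> U" "U \<subseteq> carrier_vec n" "U \<noteq> {0\<^sub>v n}"
      using that by (simp_all add: nontrivial_subspaces_iff vec_subspace_def)
    then show ?thesis by blast
  qed
  show ?thesis
  proof (intro equalityI subsetI)
    fix U assume U: "U \<in> ?M"
    then obtain v where v: "v \<in> U" "v \<in> carrier_vec n" "v \<noteq> 0\<^sub>v n" using nz by blast
    have "line v \<subseteq> U"
      using U v(1) by (auto simp: nontrivial_subspaces_iff intro: line_subset[THEN subsetD])
    then have "line v = U" using U line[OF v(2,3)] by blast
    then show "U \<in> lines n (carrier_vec n)" using v by (auto simp: lines_def)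
  next
    fix U assume "U \<in> lines n (carrier_vec n :: 'a vec set)"
    then obtain v where v: "v \<in> carrier_vec n" "v \<noteq> 0\<^sub>v n" "U = line v"
      by (auto simp: lines_def)
    have "T = U" if T: "T \<in> nontrivial_subspaces n" "T \<subseteq> U" for T
    proof -
      obtain w where w: "w \<in> T" "w \<noteq> 0\<^sub>v n" using nz[OF T(1)] by blast
      then have "line w = U" using line_eq_if_mem[OF v(1)] T(2) v(3) by blast
      moreover have "line w \<subseteq> T"
        using T(1) w(1) by (auto simp: nontrivial_subspaces_iff intro: line_subset[THEN subsetD])
      ultimately show ?thesis using T(2) by blast
    qed
    then show "U \<in> ?M" using line[OF v(1,2)] v(3) by blast
  qed
qed

section \<open>Invariants of the orthogonality graph\<close>

text \<open>
  For the orthogonality graph this is the inclusion of \<open>T\<close> in \<open>U\<close> (\<open>below_iff_subset\<close>). The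
  neighbours of the smaller subspace form the larger set, hence the order of the arguments.
\<close>
definition below :: "'v set \<Rightarrow> ('v \<Rightarrow> 'v \<Rightarrow> bool) \<Rightarrow> 'v \<Rightarrow> 'v \<Rightarrow> bool" where
  "below V R T U \<longleftrightarrow> (\<forall>X\<in>V. R U X \<longrightarrow> R T X)"

text \<open>
  Minimal vertices with respect to \<open>below\<close>. In the orthogonality graph they are the lines
  (\<open>atoms_eq_lines\<close>).
\<close>
definition atoms :: "'v set \<Rightarrow> ('v \<Rightarrow> 'v \<Rightarrow> bool) \<Rightarrow> 'v set" where
  "atoms V R = {U \<in> V. \<forall>T\<in>V. below V R T U \<longrightarrow> T = U}"

locale graph_iso =
  fixes V :: "'v set" and R :: "'v \<Rightarrow> 'v \<Rightarrow> bool"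
    and V' :: "'w set" and R' :: "'w \<Rightarrow> 'w \<Rightarrow> bool" and f :: "'v \<Rightarrow> 'w"
  assumes bij: "bij_betw f V V'"
    and adj: "\<And>u v. u \<in> V \<Longrightarrow> v \<in> V \<Longrightarrow> R' (f u) (f v) \<longleftrightarrow> R u v"
begin

lemma below_iff:
  assumes "T \<in> V" "U \<in> V"
  shows "below V' R' (f T) (f U) \<longleftrightarrow> below V R T U"
  using assms adj bij_betw_imp_surj_on[OF bij] unfolding below_def by auto

lemma image_atoms: "f ` atoms V R = atoms V' R'"
proof -
  have V': "V' = f ` V" and inj: "inj_on f V" using bij by (auto simp: bij_betw_def)
  have "f U \<in> atoms V' R' \<longleftrightarrow> U \<in> atoms V R" if "U \<in> V" for U
    using that below_iff inj_on_eq_iff[OF inj] by (auto simp: atoms_def V')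
  then show ?thesis
    unfolding set_eq_iff using V' by (auto simp: atoms_def)
qed

lemma card_atoms_transfer:
  assumes "\<And>T. T \<in> V \<Longrightarrow> Q' (f T) \<longleftrightarrow> Q T"
  shows "card {T \<in> atoms V' R'. Q' T} = card {T \<in> atoms V R. Q T}"
proof -
  have sub: "atoms V R \<subseteq> V" by (auto simp: atoms_def)
  then have "{T \<in> atoms V' R'. Q' T} = f ` {T \<in> atoms V R. Q T}"
    unfolding image_atoms[symmetric] using assms by auto
  moreover have "inj_on f {T \<in> atoms V R. Q T}"
    using bij sub by (auto simp: bij_betw_def intro: inj_on_subset)
  ultimately show ?thesis by (simp add: card_image)
qed

end

context nondegenerate_symmetric_form
begin

abbreviation "vertices \<equiv> nontrivial_subspaces n"

lemma orth_iff_subset_perp: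
  assumes "W \<subseteq> carrier_vec n"
  shows "orth B U W \<longleftrightarrow> W \<subseteq> perp n B U"
  using assms by (auto simp: orth_def perp_def)

lemma perp_zero: "perp n B {0\<^sub>v n} = carrier_vec n"
  by (auto simp: perp_def zero_left)

lemma perp_carrier: "perp n B (carrier_vec n) = {0\<^sub>v n}"
  using perp_perp[of "{0\<^sub>v n}"] perp_zero by (simp add: vec_subspace_def smult_zero_vec_zero)

lemma perp_in_vertices:
  assumes "U \<in> vertices"
  shows "perp n B U \<in> vertices"
proof -
  have U: "vec_subspace n U" "U \<noteq> {0\<^sub>v n}" "U \<noteq> carrier_vec n"
    using assms by (auto simp: nontrivial_subspaces_iff)
  then have "vec_subspace n (perp n B U)"
    by (intro vec_subspace_perp) (simp add: vec_subspace_def)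
  then show ?thesis
    using U perp_perp[OF U(1)] perp_zero perp_carrier by (auto simp: nontrivial_subspaces_iff)
qed

text \<open>
  Since \<open>perp n B U\<close> is itself a vertex and a neighbour of \<open>U\<close>, it is a neighbour of every \<open>T\<close> that
  is below \<open>U\<close>; that is, \<open>T\<close> lies in the double complement of \<open>U\<close>, which is \<open>U\<close>.
\<close>
lemma below_iff_subset:
  assumes "T \<in> vertices" "U \<in> vertices"
  shows "below vertices (orth B) T U \<longleftrightarrow> T \<subseteq> U"
proof
  assume "below vertices (orth B) T U"
  moreover have PC: "perp n B U \<subseteq> carrier_vec n" by (auto simp: perp_def)
  moreover have "orth B U (perp n B U)" by (simp add: orth_def perp_def)
  ultimately have "orth B T (perp n B U)"
    using perp_in_vertices[OF assms(2)] by (simp add: below_def)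
  then have "T \<subseteq> perp n B (perp n B U)"
    using assms(1) sym PC
    by (auto simp: orth_def perp_def nontrivial_subspaces_iff vec_subspace_def subset_iff)
  then show "T \<subseteq> U" using assms(2) perp_perp by (simp add: nontrivial_subspaces_iff)
next
  assume "T \<subseteq> U"
  then show "below vertices (orth B) T U" unfolding below_def orth_def by blast
qed

lemma atoms_eq_lines:
  assumes "n \<ge> 2"
  shows "atoms vertices (orth B) = lines n (carrier_vec n)"
proof -
  have "atoms vertices (orth B) = {U \<in> vertices. \<forall>T\<in>vertices. T \<subseteq> U \<longrightarrow> T = U}"
    using below_iff_subset unfolding atoms_def by blast
  then show ?thesis using minimal_nontrivial_subspaces[OF assms] by simp
qed

lemma card_all_atoms:
  assumes "n \<ge> 2"
  shows "CARD('a) ^ n = card (atoms vertices (orth B)) * (CARD('a) - 1) + 1"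
  using card_lines[OF vec_subspace_carrier_vec]
  unfolding atoms_eq_lines[OF assms] card_carrier_vec .

lemma card_eq_card_atoms_below:
  assumes "n \<ge> 2" "U \<in> vertices"
  shows "card U = card {T \<in> atoms vertices (orth B). below vertices (orth B) T U} * (CARD('a) - 1) + 1"
proof -
  have U: "vec_subspace n U" using assms(2) by (simp add: nontrivial_subspaces_iff)
  have "{T \<in> atoms vertices (orth B). below vertices (orth B) T U} =
      {T \<in> lines n (carrier_vec n). T \<subseteq> U}"
    unfolding atoms_eq_lines[OF assms(1), symmetric]
    using below_iff_subset[OF _ assms(2)] by (auto simp: atoms_def)
  also have "\<dots> = lines n U" by (rule lines_subset_iff[OF U, symmetric])
  finally show ?thesis using card_lines[OF U] by (simp only:)
qed

text \<open>
  The neighbours of a line \<open>U\<close> among the lines are the lines of the hyperplane \<open>perp n B U\<close>.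
\<close>
lemma card_atoms_orth:
  assumes n: "n \<ge> 2" and U: "U \<in> atoms vertices (orth B)"
  shows "CARD('a) ^ (n - 1) = card {T \<in> atoms vertices (orth B). orth B U T} * (CARD('a) - 1) + 1"
proof -
  obtain v where v: "v \<in> carrier_vec n" "v \<noteq> 0\<^sub>v n" "U = line v"
    using U by (auto simp: atoms_eq_lines[OF n] lines_def)
  have sU: "vec_subspace n U" using v vec_subspace_line by blast
  then have sP: "vec_subspace n (perp n B U)"
    by (intro vec_subspace_perp) (simp add: vec_subspace_def)
  have "n = Suc (n - 1)" using n by simp
  then have "CARD('a) ^ n = CARD('a) * CARD('a) ^ (n - 1)" by (metis power_Suc)
  then have "card (perp n B U) = CARD('a) ^ (n - 1)"
    using card_perp[OF sU] card_line[OF v(1,2)] v(3) by simp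
  moreover have "{T \<in> atoms vertices (orth B). orth B U T} = lines n (perp n B U)"
  proof -
    have tc: "T \<subseteq> carrier_vec n" if T: "T \<in> lines n (carrier_vec n)" for T
    proof -
      obtain t where "T = line t" "t \<in> carrier_vec n" using T by (auto simp: lines_def)
      then show ?thesis using line_subset[OF vec_subspace_carrier_vec] by simp
    qed
    show ?thesis
      unfolding lines_subset_iff[OF sP] atoms_eq_lines[OF n]
      by (intro Collect_cong conj_cong refl orth_iff_subset_perp tc)
  qed
  ultimately show ?thesis using card_lines[OF sP] by (simp only:)
qed

end

text \<open>
  For the number \<open>a\<close> of all atoms and the number \<open>b\<close> of atoms adjacent to a given atom, the two
  preceding counts give \<open>a = q * b + 1\<close>. As \<open>b\<close> is positive, \<open>q\<close> is determined by \<open>a\<close> and \<open>b\<close>;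
  then \<open>q ^ n\<close> is determined by \<open>a\<close>, and the cardinality of a vertex by the number of atoms
  below it.
\<close>
lemma orthogonality_graph_determines_cardinalities:
  fixes B1 :: "'a::{field,finite} vec \<Rightarrow> 'a vec \<Rightarrow> 'a" and B2 :: "'b::{field,finite} vec \<Rightarrow> 'b vec \<Rightarrow> 'b"
  assumes B1: "nondegenerate_symmetric_form n1 B1" and B2: "nondegenerate_symmetric_form n2 B2"
    and n: "n1 \<ge> 2" "n2 \<ge> 2"
    and iso: "graph_iso (nontrivial_subspaces n1) (orth B1) (nontrivial_subspaces n2) (orth B2) f"
  shows "CARD('a) = CARD('b)" "n1 = n2"
    "\<And>U. U \<in> nontrivial_subspaces n1 \<Longrightarrow> card (f U) = card U"
proof -
  interpret F1: nondegenerate_symmetric_form n1 B1 by (rule B1)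
  interpret F2: nondegenerate_symmetric_form n2 B2 by (rule B2)
  interpret graph_iso F1.vertices "orth B1" F2.vertices "orth B2" f by (rule iso)
  let ?q1 = "CARD('a)" and ?q2 = "CARD('b)"
  let ?A1 = "atoms F1.vertices (orth B1)" and ?A2 = "atoms F2.vertices (orth B2)"
  have q: "1 < ?q1" "1 < ?q2" by (rule one_less_card_field)+
  have A: "card ?A2 = card ?A1"
    using card_atoms_transfer[of "\<lambda>_. True" "\<lambda>_. True"] by simp
  have "1 < ?q1 ^ n1" using q(1) n(1) by (intro one_less_power) auto
  then have "card ?A1 \<noteq> 0" using F1.card_all_atoms[OF n(1)] by (cases "card ?A1 = 0") auto
  then obtain U where U: "U \<in> ?A1" by fastforce
  then have UV: "U \<in> F1.vertices" and fU: "f U \<in> ?A2" using image_atoms by (auto simp: atoms_def)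
  let ?B1 = "card {T \<in> ?A1. orth B1 U T}" and ?B2 = "card {T \<in> ?A2. orth B2 (f U) T}"
  have B: "?B2 = ?B1" using card_atoms_transfer adj UV by blast
  have rec: "a = q * b + 1"
    if "1 < q" "2 \<le> n" "q ^ n = a * (q - 1) + 1" "q ^ (n - 1) = b * (q - 1) + 1" for a b q n :: nat
  proof -
    obtain k where k: "q = Suc k" "k \<noteq> 0" using \<open>1 < q\<close> by (cases q) auto
    have "q ^ n = q * q ^ (n - 1)" using \<open>2 \<le> n\<close> by (cases n) auto
    then have "a * k + 1 = Suc k * (b * k + 1)" using that(3,4) k(1) by simp
    then have "k * a = k * (Suc k * b + 1)" by (simp add: algebra_simps)
    then show ?thesis unfolding k(1) by (rule mult_left_cancel[OF k(2), THEN iffD1])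
  qed
  have r1: "card ?A1 = ?q1 * ?B1 + 1"
    by (rule rec[OF q(1) n(1) F1.card_all_atoms[OF n(1)] F1.card_atoms_orth[OF n(1) U]])
  have r2: "card ?A1 = ?q2 * ?B1 + 1"
    using rec[OF q(2) n(2) F2.card_all_atoms[OF n(2)] F2.card_atoms_orth[OF n(2) fU]] A B by simp
  have "1 < ?q1 ^ (n1 - 1)" using q(1) n(1) by (intro one_less_power) auto
  then have "?B1 \<noteq> 0" using F1.card_atoms_orth[OF n(1) U] by (cases "?B1 = 0") auto
  then show qq: "?q1 = ?q2" using r1 r2 by simp
  have "?q1 ^ n1 = ?q1 ^ n2"
    using F1.card_all_atoms[OF n(1)] F2.card_all_atoms[OF n(2)] A qq by simp
  then show "n1 = n2" using q(1) by (metis power_inject_exp)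
  fix U :: "'a vec set" assume U: "U \<in> nontrivial_subspaces n1"
  then have "f U \<in> F2.vertices" using bij by (blast intro: bij_betwE[THEN bspec])
  have "card (f U) = card {T \<in> ?A2. below F2.vertices (orth B2) T (f U)} * (?q2 - 1) + 1"
    by (rule F2.card_eq_card_atoms_below[OF n(2) \<open>f U \<in> F2.vertices\<close>])
  also have "card {T \<in> ?A2. below F2.vertices (orth B2) T (f U)} =
      card {T \<in> ?A1. below F1.vertices (orth B1) T U}"
    by (rule card_atoms_transfer) (rule below_iff[OF _ U])
  also have "\<dots> * (?q2 - 1) + 1 = card U"
    unfolding qq[symmetric] by (rule F1.card_eq_card_atoms_below[OF n(1) U, symmetric])
  finally show "card (f U) = card U" .
qed

section \<open>The form given by a hyperbolic and an anisotropic part\<close>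

text \<open>
  The form of a monomial matrix, whose row \<open>i\<close> has the single entry \<open>d i\<close> in column \<open>\<sigma> i\<close>. Both the
  form of \<open>S\<close> and the standard scalar product have this shape, and both are needed: the latter
  enters the bound on totally isotropic subspaces.
\<close>
definition pairing :: "nat \<Rightarrow> (nat \<Rightarrow> nat) \<Rightarrow> (nat \<Rightarrow> 'a) \<Rightarrow> 'a::field vec \<Rightarrow> 'a vec \<Rightarrow> 'a" where
  "pairing n \<sigma> d u w = (\<Sum>i<n. d i * (u $ i * w $ \<sigma> i))"

lemma nondegenerate_symmetric_form_pairing:
  fixes d :: "nat \<Rightarrow> 'a::{field,finite}"
  assumes \<sigma>: "\<And>i. i < n \<Longrightarrow> \<sigma> i < n" "\<And>i. i < n \<Longrightarrow> \<sigma> (\<sigma> i) = i"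
    and d: "\<And>i. i < n \<Longrightarrow> d (\<sigma> i) = d i" "\<And>i. i < n \<Longrightarrow> d i \<noteq> 0"
  shows "nondegenerate_symmetric_form n (pairing n \<sigma> d)"
proof
  fix u v w :: "'a vec" and c
  assume u: "u \<in> carrier_vec n" and v: "v \<in> carrier_vec n" and w: "w \<in> carrier_vec n"
  show "pairing n \<sigma> d (u + v) w = pairing n \<sigma> d u w + pairing n \<sigma> d v w"
    unfolding pairing_def sum.distrib[symmetric]
    using u v w by (intro sum.cong) (auto simp: algebra_simps)
next
  fix u w :: "'a vec" and c
  assume u: "u \<in> carrier_vec n" and w: "w \<in> carrier_vec n"
  show "pairing n \<sigma> d (c \<cdot>\<^sub>v u) w = c * pairing n \<sigma> d u w"
    unfolding pairing_def sum_distrib_left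
    using u w by (intro sum.cong) (auto simp: algebra_simps)
next
  fix u w :: "'a vec"
  assume u: "u \<in> carrier_vec n" and w: "w \<in> carrier_vec n"
  show "pairing n \<sigma> d u w = pairing n \<sigma> d w u"
    unfolding pairing_def
    by (rule sum.reindex_bij_witness[where i = \<sigma> and j = \<sigma>]) (auto simp: \<sigma> d mult.commute)
next
  fix u :: "'a vec"
  assume u: "u \<in> carrier_vec n" and z: "\<And>w. w \<in> carrier_vec n \<Longrightarrow> pairing n \<sigma> d u w = 0"
  have "u $ i = 0" if i: "i < n" for i
  proof -
    have "\<sigma> j = \<sigma> i \<longleftrightarrow> j = i" if "j < n" for j using that i \<sigma>(2) by metis
    then have "pairing n \<sigma> d u (unit_vec n (\<sigma> i)) = (\<Sum>j<n. if j = i then d i * u $ i else 0)"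
      unfolding pairing_def using \<sigma>(1) i by (intro sum.cong) auto
    also have "\<dots> = d i * u $ i" using i by simp
    finally show ?thesis using z[of "unit_vec n (\<sigma> i)"] d(2)[OF i] by simp
  qed
  then show "u = 0\<^sub>v n" using u by (intro eq_vecI) auto
qed

text \<open>
  The position of the nonzero entry in row \<open>i\<close> of \<open>S\<close>: the first two blocks of \<open>\<nu>\<close> coordinates are
  exchanged, the last \<open>\<delta>\<close> coordinates are fixed.
\<close>
definition hyperbolic_swap :: "nat \<Rightarrow> nat \<Rightarrow> nat" where
  "hyperbolic_swap \<nu> i = (if i < \<nu> then \<nu> + i else if i < 2 * \<nu> then i - \<nu> else i)"

lemma hyperbolic_swap_simps [simp]:
  "i < \<nu> \<Longrightarrow> hyperbolic_swap \<nu> i = \<nu> + i"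
  "i < \<nu> \<Longrightarrow> hyperbolic_swap \<nu> (\<nu> + i) = i"
  "hyperbolic_swap \<nu> (2 * \<nu> + k) = 2 * \<nu> + k"
  by (simp_all add: hyperbolic_swap_def)

lemma block_index_cases:
  fixes i \<nu> \<delta> :: nat
  assumes "i < 2 * \<nu> + \<delta>"
  obtains "i < \<nu>" | j where "j < \<nu>" "i = \<nu> + j" | k where "k < \<delta>" "i = 2 * \<nu> + k"
proof (cases "i < 2 * \<nu>")
  case True
  show thesis
  proof (cases "i < \<nu>")
    case False
    show thesis by (rule that(2)[of "i - \<nu>"]) (use False True in simp_all)
  qed (rule that(1))
next
  case False
  show thesis by (rule that(3)[of "i - 2 * \<nu>"]) (use False assms in simp_all)
qed

definition diag_coeff :: "nat \<Rightarrow> (nat \<Rightarrow> 'a::one) \<Rightarrow> nat \<Rightarrow> 'a" where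
  "diag_coeff \<nu> D i = (if i < 2 * \<nu> then 1 else D (i - 2 * \<nu>))"

lemma diag_coeff_simps [simp]:
  "i < \<nu> \<Longrightarrow> diag_coeff \<nu> D i = 1"
  "i < \<nu> \<Longrightarrow> diag_coeff \<nu> D (\<nu> + i) = 1"
  "diag_coeff \<nu> D (2 * \<nu> + k) = D k"
  by (simp_all add: diag_coeff_def)

definition witt_form :: "nat \<Rightarrow> nat \<Rightarrow> (nat \<Rightarrow> 'a) \<Rightarrow> 'a::field vec \<Rightarrow> 'a vec \<Rightarrow> 'a" where
  "witt_form \<nu> \<delta> D = pairing (2 * \<nu> + \<delta>) (hyperbolic_swap \<nu>) (diag_coeff \<nu> D)"

definition anisotropic :: "nat \<Rightarrow> (nat \<Rightarrow> 'a::field) \<Rightarrow> bool" where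
  "anisotropic \<delta> D \<longleftrightarrow> (\<forall>x. (\<Sum>k<\<delta>. D k * (x k)\<^sup>2) = 0 \<longrightarrow> (\<forall>k<\<delta>. x k = 0))"

text \<open>
  Otherwise the \<open>k\<close>-th unit vector would be isotropic.
\<close>
lemma anisotropic_nonzero:
  assumes "anisotropic \<delta> D" "k < \<delta>"
  shows "D k \<noteq> 0"
proof
  assume "D k = 0"
  then have "(\<Sum>j<\<delta>. D j * (of_bool (j = k))\<^sup>2) = 0"
    by (intro sum.neutral) auto
  then have "of_bool (k = k) = (0 :: 'a)"
    using assms(1)[unfolded anisotropic_def, THEN spec, of "\<lambda>j. of_bool (j = k)"] assms(2) by blast
  then show False by simp
qed

lemma nondegenerate_symmetric_form_witt_form:
  fixes D :: "nat \<Rightarrow> 'a::{field,finite}"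
  assumes "anisotropic \<delta> D"
  shows "nondegenerate_symmetric_form (2 * \<nu> + \<delta>) (witt_form \<nu> \<delta> D)"
  unfolding witt_form_def
proof (rule nondegenerate_symmetric_form_pairing)
  fix i assume i: "i < 2 * \<nu> + \<delta>"
  show "hyperbolic_swap \<nu> i < 2 * \<nu> + \<delta>"
    by (rule block_index_cases[OF i]) simp_all
  show "hyperbolic_swap \<nu> (hyperbolic_swap \<nu> i) = i"
    by (rule block_index_cases[OF i]) simp_all
  show "diag_coeff \<nu> D (hyperbolic_swap \<nu> i) = diag_coeff \<nu> D i"
    by (rule block_index_cases[OF i]) simp_all
  show "diag_coeff \<nu> D i \<noteq> 0"
    by (rule block_index_cases[OF i]) (simp_all add: anisotropic_nonzero[OF assms])
qed

lemma sum_three_blocks: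
  fixes f :: "nat \<Rightarrow> 'a::comm_monoid_add"
  shows "(\<Sum>i<2 * \<nu> + \<delta>. f i) = (\<Sum>i<\<nu>. f i) + (\<Sum>i<\<nu>. f (\<nu> + i)) + (\<Sum>k<\<delta>. f (2 * \<nu> + k))"
proof -
  have split: "(\<Sum>i<m + k. g i) = (\<Sum>i<m. g i) + (\<Sum>i<k. g (m + i))"
    for m k and g :: "nat \<Rightarrow> 'a"
    by (induction k) (simp_all add: add.assoc)
  show ?thesis
    using split[of f "2 * \<nu>" \<delta>] split[of f \<nu> \<nu>] by (simp add: mult_2)
qed

lemma witt_form_blocks:
  "witt_form \<nu> \<delta> D u w = (\<Sum>i<\<nu>. u $ i * w $ (\<nu> + i)) + (\<Sum>i<\<nu>. u $ (\<nu> + i) * w $ i) +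
     (\<Sum>k<\<delta>. D k * (u $ (2 * \<nu> + k) * w $ (2 * \<nu> + k)))"
  unfolding witt_form_def pairing_def sum_three_blocks by simp

lemma S_mat_carrier:
  assumes "\<Delta> \<in> carrier_mat \<delta> \<delta>"
  shows "S_mat \<nu> \<delta> \<Delta> \<in> carrier_mat (2 * \<nu> + \<delta>) (2 * \<nu> + \<delta>)"
proof -
  have "four_block_mat (0\<^sub>m \<nu> \<nu>) (1\<^sub>m \<nu>) (1\<^sub>m \<nu>) (0\<^sub>m \<nu> \<nu>) \<in> carrier_mat (2 * \<nu>) (2 * \<nu>)"
    unfolding mult_2 by (rule four_block_carrier_mat) (rule zero_carrier_mat)+
  then show ?thesis
    unfolding S_mat_def by (rule four_block_carrier_mat) (rule assms)
qed

lemma S_mat_entry: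
  fixes \<Delta> :: "'a::field mat"
  assumes \<Delta>: "\<Delta> \<in> carrier_mat \<delta> \<delta>"
    and D: "\<And>i j. i < \<delta> \<Longrightarrow> j < \<delta> \<Longrightarrow> \<Delta> $$ (i, j) = (if i = j then D i else 0)"
    and ij: "i < 2 * \<nu> + \<delta>" "j < 2 * \<nu> + \<delta>"
  shows "S_mat \<nu> \<delta> \<Delta> $$ (i, j) = (if j = hyperbolic_swap \<nu> i then diag_coeff \<nu> D i else 0)"
proof -
  let ?H = "four_block_mat (0\<^sub>m \<nu> \<nu>) (1\<^sub>m \<nu>) (1\<^sub>m \<nu>) (0\<^sub>m \<nu> \<nu>) :: 'a mat"
  have H: "?H \<in> carrier_mat (2 * \<nu>) (2 * \<nu>)" 
    unfolding mult_2 by (rule four_block_carrier_mat) (rule zero_carrier_mat)+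
  have "S_mat \<nu> \<delta> \<Delta> $$ (i, j) =
      (if i < 2 * \<nu> then if j < 2 * \<nu> then ?H $$ (i, j) else 0
       else if j < 2 * \<nu> then 0 else \<Delta> $$ (i - 2 * \<nu>, j - 2 * \<nu>))"
    unfolding S_mat_def
    using ij carrier_matD[OF \<Delta>] carrier_matD[OF H] by (subst index_mat_four_block) (simp_all flip: mult_2)
  also have "\<dots> = (if i < 2 * \<nu> then if j < 2 * \<nu> then
          if i < \<nu> then if j < \<nu> then 0 else if i = j - \<nu> then 1 else 0
          else if j < \<nu> then if i - \<nu> = j then 1 else 0 else 0
        else 0
       else if j < 2 * \<nu> then 0 else \<Delta> $$ (i - 2 * \<nu>, j - 2 * \<nu>))"
    by (simp cong: if_cong)
  also have "\<dots> = (if j = hyperbolic_swap \<nu> i then diag_coeff \<nu> D i else 0)"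
    by (rule block_index_cases[OF ij(1)]; rule block_index_cases[OF ij(2)]) (simp_all add: D)
  finally show ?thesis .
qed

lemma scalar_prod_S_mat:
  fixes \<Delta> :: "'a::field mat"
  assumes \<Delta>: "\<Delta> \<in> carrier_mat \<delta> \<delta>"
    and D: "\<And>i j. i < \<delta> \<Longrightarrow> j < \<delta> \<Longrightarrow> \<Delta> $$ (i, j) = (if i = j then D i else 0)"
    and u: "u \<in> carrier_vec (2 * \<nu> + \<delta>)" and w: "w \<in> carrier_vec (2 * \<nu> + \<delta>)"
  shows "u \<bullet> (S_mat \<nu> \<delta> \<Delta> *\<^sub>v w) = witt_form \<nu> \<delta> D u w"
proof -
  let ?n = "2 * \<nu> + \<delta>" and ?S = "S_mat \<nu> \<delta> \<Delta>"
  have S: "?S \<in> carrier_mat ?n ?n" by (rule S_mat_carrier[OF \<Delta>])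
  have Sw: "(?S *\<^sub>v w) $ i = diag_coeff \<nu> D i * w $ hyperbolic_swap \<nu> i" if i: "i < ?n" for i
  proof -
    have "hyperbolic_swap \<nu> i < ?n" using i by (auto simp: hyperbolic_swap_def)
    have "(?S *\<^sub>v w) $ i = (\<Sum>j\<in>{0..<?n}. ?S $$ (i, j) * w $ j)"
      using S w i by (auto simp: scalar_prod_def intro!: sum.cong)
    also have "\<dots> = (\<Sum>j\<in>{0..<?n}. if j = hyperbolic_swap \<nu> i then diag_coeff \<nu> D i * w $ j else 0)"
      using S_mat_entry[OF \<Delta> D i] by (intro sum.cong) auto
    also have "\<dots> = diag_coeff \<nu> D i * w $ hyperbolic_swap \<nu> i"
      using \<open>hyperbolic_swap \<nu> i < ?n\<close> by simp
    finally show ?thesis .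
  qed
  have "u \<bullet> (?S *\<^sub>v w) = (\<Sum>i\<in>{0..<?n}. u $ i * (?S *\<^sub>v w) $ i)"
    using S by (simp add: scalar_prod_def)
  also have "\<dots> = (\<Sum>i<?n. diag_coeff \<nu> D i * (u $ i * w $ hyperbolic_swap \<nu> i))"
    unfolding lessThan_atLeast0 using Sw by (intro sum.cong) (auto simp: algebra_simps)
  finally show ?thesis by (simp add: witt_form_def pairing_def)
qed

text \<open>
  The block for \<open>\<delta> = 2\<close> is anisotropic because \<open>x\<^sup>2 - z * y\<^sup>2 = 0\<close> with \<open>y \<noteq> 0\<close> would make \<open>z\<close> the
  square of \<open>x / y\<close>.
\<close>
lemma Delta_blocks_diagonal:
  fixes z :: "'a::field"
  assumes \<Delta>: "\<Delta> \<in> Delta_blocks z \<delta>" and z: "\<nexists>x. z = x\<^sup>2"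
  shows "\<Delta> \<in> carrier_mat \<delta> \<delta>"
    "\<And>i j. i < \<delta> \<Longrightarrow> j < \<delta> \<Longrightarrow> \<Delta> $$ (i, j) = (if i = j then \<Delta> $$ (i, i) else 0)"
    "anisotropic \<delta> (\<lambda>k. \<Delta> $$ (k, k))"
proof -
  have z0: "z \<noteq> 0" using z by (metis zero_power2)
  consider "\<delta> = 0" "\<Delta> = 0\<^sub>m 0 0" | a where "\<delta> = 1" "\<Delta> = mat_of_rows_list 1 [[a]]" "a \<noteq> 0"
    | "\<delta> = 2" "\<Delta> = mat_of_rows_list 2 [[1, 0], [0, - z]]"
    using \<Delta> z0 unfolding Delta_blocks_def by (auto split: if_splits)
  then have "\<Delta> \<in> carrier_mat \<delta> \<delta> \<and>
      (\<forall>i<\<delta>. \<forall>j<\<delta>. \<Delta> $$ (i, j) = (if i = j then \<Delta> $$ (i, i) else 0)) \<and>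
      anisotropic \<delta> (\<lambda>k. \<Delta> $$ (k, k))"
  proof cases
    case 1
    then show ?thesis by (simp add: anisotropic_def)
  next
    case (2 a)
    then show ?thesis by (auto simp: anisotropic_def mat_of_rows_list_def)
  next
    case 3
    have "x 0 = 0 \<and> x 1 = 0" if "(x 0)\<^sup>2 + - z * (x 1)\<^sup>2 = 0" for x :: "nat \<Rightarrow> 'a"
    proof (cases "x 1 = 0")
      case False
      then have "z = (x 0 / x 1)\<^sup>2" using that by (simp add: power_divide field_simps)
      then show ?thesis using z by blast
    qed (use that in simp)
    then have "anisotropic \<delta> (\<lambda>k. \<Delta> $$ (k, k))"
      using 3 by (auto simp: anisotropic_def mat_of_rows_list_def numeral_2_eq_2 less_Suc_eq)
    moreover have "\<Delta> \<in> carrier_mat \<delta> \<delta>"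
      using 3 by (auto simp: mat_of_rows_list_def numeral_2_eq_2)
    moreover have "\<Delta> $$ (i, j) = (if i = j then \<Delta> $$ (i, i) else 0)" if "i < \<delta>" "j < \<delta>" for i j
      using 3 that by (auto simp: mat_of_rows_list_def numeral_2_eq_2 less_Suc_eq)
    ultimately show ?thesis by blast
  qed
  then show "\<Delta> \<in> carrier_mat \<delta> \<delta>"
    "\<And>i j. i < \<delta> \<Longrightarrow> j < \<delta> \<Longrightarrow> \<Delta> $$ (i, j) = (if i = j then \<Delta> $$ (i, i) else 0)"
    "anisotropic \<delta> (\<lambda>k. \<Delta> $$ (k, k))" by blast+
qed

section \<open>The Witt index\<close>

text \<open>
  Write the vectors as \<open>(x, y, d)\<close> with blocks of lengths \<open>\<nu>\<close>, \<open>\<nu>\<close> and \<open>\<delta>\<close>, and let \<open>K\<close> be the kernel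
  of the projection \<open>y\<close> on \<open>U\<close>. For an element of \<open>K\<close> the quadratic form reduces to its value at
  \<open>d\<close>, so \<open>d = 0\<close> by anisotropy, and the element is determined by \<open>x\<close>. Orthogonality of
  \<open>(x, 0, 0)\<close> to an arbitrary element of \<open>U\<close> says that \<open>x\<close> has scalar product zero with the
  \<open>y\<close>-block of that element. So \<open>x ` K\<close> is contained in the orthogonal complement of \<open>y ` U\<close> for
  the standard scalar product, and
  \<open>card U = card (y ` U) * card K \<le> card (y ` U) * card (perp (y ` U)) = q ^ \<nu>\<close>.
\<close>
lemma card_totally_isotropic_le:
  fixes D :: "nat \<Rightarrow> 'a::{field,finite}"
  assumes D: "anisotropic \<delta> D" and U: "vec_subspace (2 * \<nu> + \<delta>) U"
    and iso: "orth (witt_form \<nu> \<delta> D) U U"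
  shows "card U \<le> CARD('a) ^ \<nu>"
proof -
  let ?n = "2 * \<nu> + \<delta>" and ?dot = "pairing \<nu> (\<lambda>i. i) (\<lambda>_. 1 :: 'a)"
  interpret dot: nondegenerate_symmetric_form \<nu> ?dot
    by (rule nondegenerate_symmetric_form_pairing) auto
  define x where "x = (\<lambda>u. vec \<nu> (\<lambda>i. u $ i :: 'a))"
  define y where "y = (\<lambda>u. vec \<nu> (\<lambda>i. u $ (\<nu> + i) :: 'a))"
  define K where "K = {u \<in> U. y u = y (0\<^sub>v ?n)}"
  have UC: "u \<in> carrier_vec ?n" if "u \<in> U" for u by (rule vec_subspace_carrier[OF U that])
  have Ky: "u $ (\<nu> + i) = 0" if "u \<in> K" "i < \<nu>" for u i
  proof -
    have "y u $ i = y (0\<^sub>v ?n) $ i" using that by (simp add: K_def)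
    then show ?thesis using that(2) by (simp add: y_def)
  qed
  have Kd: "u $ (2 * \<nu> + k) = 0" if u: "u \<in> K" and k: "k < \<delta>" for u k
  proof -
    have "witt_form \<nu> \<delta> D u u = 0" using iso u by (simp add: orth_def K_def)
    then have "(\<Sum>k<\<delta>. D k * (u $ (2 * \<nu> + k))\<^sup>2) = 0"
      using Ky[OF u] by (simp add: witt_form_blocks power2_eq_square)
    then show ?thesis
      using D[unfolded anisotropic_def, THEN spec, of "\<lambda>k. u $ (2 * \<nu> + k)"] k by blast
  qed
  have card_U: "card U = card (y ` U) * card K"
    unfolding K_def
  proof (rule card_eq_image_times_kernel[OF U])
    fix u v assume "u \<in> U" "v \<in> U"
    then show "y u = y v \<longleftrightarrow> y (u - v) = y (0\<^sub>v ?n)"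
      using UC[of u] UC[of v] by (auto simp: y_def vec_eq_iff)
  qed
  have "inj_on x K"
  proof (rule inj_onI)
    fix u v assume uv: "u \<in> K" "v \<in> K" "x u = x v"
    have "u $ i = v $ i" if "i < ?n" for i
    proof -
      consider "i < \<nu>" | "\<nu> \<le> i" "i < 2 * \<nu>" | "2 * \<nu> \<le> i" by linarith
      then show ?thesis
      proof cases
        case 1
        have "x u $ i = x v $ i" using uv(3) by simp
        then show ?thesis using 1 by (simp add: x_def)
      next
        case 2
        then show ?thesis using Ky[OF uv(1), of "i - \<nu>"] Ky[OF uv(2), of "i - \<nu>"] by simp
      next
        case 3
        then show ?thesis
          using that Kd[OF uv(1), of "i - 2 * \<nu>"] Kd[OF uv(2), of "i - 2 * \<nu>"] by simp
      qed
    qed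
    then show "u = v" using UC[of u] UC[of v] uv by (intro eq_vecI) (auto simp: K_def)
  qed
  then have card_K: "card K = card (x ` K)" by (simp add: card_image)
  have Y: "vec_subspace \<nu> (y ` U)"
  proof -
    have "0\<^sub>v \<nu> = y (0\<^sub>v ?n)" by (intro eq_vecI) (auto simp: y_def)
    then have "0\<^sub>v \<nu> \<in> y ` U" using vec_subspace_zero[OF U] by blast
    moreover have "y u + y v \<in> y ` U" if "u \<in> U" "v \<in> U" for u v
    proof -
      have "y u + y v = y (u + v)" using UC[OF that(1)] UC[OF that(2)] by (intro eq_vecI) (auto simp: y_def)
      then show ?thesis using vec_subspace_add[OF U that] by blast
    qed
    moreover have "c \<cdot>\<^sub>v y u \<in> y ` U" if "u \<in> U" for c u
    proof -
      have "c \<cdot>\<^sub>v y u = y (c \<cdot>\<^sub>v u)" using UC[OF that] by (intro eq_vecI) (auto simp: y_def)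
      then show ?thesis using vec_subspace_smult[OF U that] by blast
    qed
    moreover have "y ` U \<subseteq> carrier_vec \<nu>" by (auto simp: y_def)
    ultimately show ?thesis by (auto simp: vec_subspace_def)
  qed
  have "?dot (y w) (x u) = 0" if u: "u \<in> K" and w: "w \<in> U" for u w
  proof -
    have "witt_form \<nu> \<delta> D u w = 0" using iso u w by (simp add: orth_def K_def)
    then show ?thesis
      using Ky[OF u] Kd[OF u] by (simp add: witt_form_blocks pairing_def x_def y_def mult.commute)
  qed
  then have "x ` K \<subseteq> perp \<nu> ?dot (y ` U)"
    by (auto simp: perp_def x_def)
  moreover have "finite (perp \<nu> ?dot (y ` U))"
    by (rule finite_subset[of _ "carrier_vec \<nu>"]) (auto simp: perp_def)
  ultimately have "card (x ` K) \<le> card (perp \<nu> ?dot (y ` U))" by (rule card_mono[rotated])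
  then have "card U \<le> card (y ` U) * card (perp \<nu> ?dot (y ` U))"
    unfolding card_U card_K by (rule mult_left_mono) simp
  then show ?thesis using dot.card_perp[OF Y] by simp
qed

text \<open>
  The witness consists of the vectors supported on the first \<open>\<nu>\<close> coordinates. It is a vertex only
  for \<open>\<nu> > 0\<close>: in an anisotropic space no vertex has a loop.
\<close>
lemma totally_isotropic_exists:
  assumes n: "2 * \<nu> + \<delta> \<ge> 2" and \<nu>: "\<nu> > 0"
  obtains U :: "'a::{field,finite} vec set"
  where "U \<in> nontrivial_subspaces (2 * \<nu> + \<delta>)" "orth (witt_form \<nu> \<delta> D) U U"
    "card U = CARD('a) ^ \<nu>"
proof -
  let ?n = "2 * \<nu> + \<delta>"
  define U where "U = {u \<in> carrier_vec ?n :: 'a vec set. \<forall>i<?n. \<nu> \<le> i \<longrightarrow> u $ i = 0}"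
  have sub: "vec_subspace ?n U" by (auto simp: vec_subspace_def U_def)
  have "bij_betw (\<lambda>u. vec \<nu> (\<lambda>i. u $ i)) U (carrier_vec \<nu>)"
  proof (rule bij_betw_byWitness[where f' = "\<lambda>x. vec ?n (\<lambda>i. if i < \<nu> then x $ i else 0)"])
    show "\<forall>u\<in>U. vec ?n (\<lambda>i. if i < \<nu> then vec \<nu> (\<lambda>i. u $ i) $ i else 0) = u"
      by (auto simp: U_def intro!: eq_vecI)
    show "\<forall>x\<in>carrier_vec \<nu>. vec \<nu> (\<lambda>i. vec ?n (\<lambda>i. if i < \<nu> then x $ i else 0) $ i) = x"
      by (auto intro!: eq_vecI)
  qed (auto simp: U_def)
  then have "card U = card (carrier_vec \<nu> :: 'a vec set)" by (rule bij_betw_same_card)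
  then have card: "card U = CARD('a) ^ \<nu>" by (simp add: card_carrier_vec)
  have q: "1 < CARD('a)" by (rule one_less_card_field)
  have "card U < CARD('a) ^ ?n" unfolding card
    using q \<nu> by (intro power_strict_increasing) auto
  then have "U \<noteq> carrier_vec ?n" by (auto simp: card_carrier_vec)
  moreover have "1 < card U" unfolding card using q \<nu> by (intro one_less_power) auto
  then have "U \<noteq> {0\<^sub>v ?n}" by auto
  moreover have "orth (witt_form \<nu> \<delta> D) U U"
    by (auto simp: orth_def U_def witt_form_blocks)
  ultimately show ?thesis using sub card by (intro that[of U]) (auto simp: nontrivial_subspaces_iff)
qed

lemma same_witt_index:
  fixes D1 :: "nat \<Rightarrow> 'a::{field,finite}" and D2 :: "nat \<Rightarrow> 'b::{field,finite}"
  assumes D: "anisotropic \<delta>1 D1" "anisotropic \<delta>2 D2"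
    and n: "2 * \<nu>1 + \<delta>1 \<ge> 2" "2 * \<nu>2 + \<delta>2 \<ge> 2"
    and iso: "graph_iso (nontrivial_subspaces (2 * \<nu>1 + \<delta>1)) (orth (witt_form \<nu>1 \<delta>1 D1))
      (nontrivial_subspaces (2 * \<nu>2 + \<delta>2)) (orth (witt_form \<nu>2 \<delta>2 D2)) f"
    and q: "CARD('a) = CARD('b)"
    and card: "\<And>U. U \<in> nontrivial_subspaces (2 * \<nu>1 + \<delta>1) \<Longrightarrow> card (f U) = card U"
  shows "\<nu>1 = \<nu>2"
proof -
  interpret graph_iso "nontrivial_subspaces (2 * \<nu>1 + \<delta>1)" "orth (witt_form \<nu>1 \<delta>1 D1)"
    "nontrivial_subspaces (2 * \<nu>2 + \<delta>2)" "orth (witt_form \<nu>2 \<delta>2 D2)" f by (rule iso)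
  let ?q = "CARD('a)"
  have q1: "1 < ?q" by (rule one_less_card_field)
  have le: "a \<le> b" if "?q ^ a \<le> ?q ^ b" for a b
    using that q1 by (metis power_increasing_iff)
  have "\<nu>1 \<le> \<nu>2"
  proof (cases "\<nu>1 = 0")
    case False
    then obtain U :: "'a vec set" where U: "U \<in> nontrivial_subspaces (2 * \<nu>1 + \<delta>1)"
      "orth (witt_form \<nu>1 \<delta>1 D1) U U" "card U = ?q ^ \<nu>1"
      using totally_isotropic_exists[OF n(1), of D1] by blast
    have "f U \<in> nontrivial_subspaces (2 * \<nu>2 + \<delta>2)"
      using bij_betwE[OF bij] U(1) by blast
    then have "card (f U) \<le> CARD('b) ^ \<nu>2"
      using card_totally_isotropic_le[OF D(2)] adj[OF U(1) U(1)] U(2)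
      by (simp add: nontrivial_subspaces_iff)
    then show ?thesis using le card[OF U(1)] U(3) q by simp
  qed simp
  moreover have "\<nu>2 \<le> \<nu>1"
  proof (cases "\<nu>2 = 0")
    case False
    then obtain W :: "'b vec set" where W: "W \<in> nontrivial_subspaces (2 * \<nu>2 + \<delta>2)"
      "orth (witt_form \<nu>2 \<delta>2 D2) W W" "card W = CARD('b) ^ \<nu>2"
      using totally_isotropic_exists[OF n(2), of D2] by blast
    obtain U where U: "U \<in> nontrivial_subspaces (2 * \<nu>1 + \<delta>1)" "W = f U"
      using bij_betw_imp_surj_on[OF bij] W(1) by blast
    then have "card U \<le> ?q ^ \<nu>1"
      using card_totally_isotropic_le[OF D(1)] adj[OF U(1) U(1)] W(2)
      by (simp add: nontrivial_subspaces_iff)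
    then show ?thesis using le card[OF U(1)] U(2) W(3) q by simp
  qed simp
  ultimately show ?thesis by simp
qed

section \<open>Semilinear similarities\<close>

lemma additive_zero:
  fixes h :: "'a::group_add \<Rightarrow> 'b::group_add"
  assumes "\<And>x y. h (x + y) = h x + h y"
  shows "h 0 = 0"
  using assms[of 0 0] by (metis add.right_neutral add_left_cancel)

text \<open>
  Such a map \<open>\<phi>\<close> is bijective and semilinear, so it carries subspaces to subspaces in both
  directions, and it preserves the vanishing of the form because \<open>c \<noteq> 0\<close>.
\<close>
lemma graph_iso_semilinear:
  fixes h :: "'a::{field,finite} \<Rightarrow> 'b::{field,finite}" and c :: 'b
  defines "\<phi> n e \<equiv> (\<lambda>u. vec n (\<lambda>i. e i * h (u $ i)))"
  assumes h: "bij h" "\<And>x y. h (x + y) = h x + h y" "\<And>x y. h (x * y) = h x * h y"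
    and e: "\<And>i. i < n \<Longrightarrow> e i \<noteq> 0" and c: "c \<noteq> 0"
    and form: "\<And>u w. u \<in> carrier_vec n \<Longrightarrow> w \<in> carrier_vec n \<Longrightarrow>
      B2 (\<phi> n e u) (\<phi> n e w) = c * h (B1 u w)"
  shows "graph_iso (nontrivial_subspaces n) (orth B1) (nontrivial_subspaces n) (orth B2) ((`) (\<phi> n e))"
proof -
  let ?f = "\<phi> n e"
  have h0: "h 0 = 0" by (rule additive_zero) (rule h(2))
  have hz: "h x = 0 \<longleftrightarrow> x = 0" for x using h0 bij_is_inj[OF h(1)] by (metis injD)
  have fC: "?f u \<in> carrier_vec n" for u by (simp add: \<phi>_def)
  have fbij: "bij_betw ?f (carrier_vec n) (carrier_vec n)"
  proof (rule bij_betw_byWitness[where f' = "\<lambda>w. vec n (\<lambda>i. inv_into UNIV h (w $ i / e i))"])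
    show "\<forall>u\<in>carrier_vec n. vec n (\<lambda>i. inv_into UNIV h (?f u $ i / e i)) = u"
      using e bij_is_inj[OF h(1)] by (auto simp: \<phi>_def intro!: eq_vecI)
    show "\<forall>w\<in>carrier_vec n. ?f (vec n (\<lambda>i. inv_into UNIV h (w $ i / e i))) = w"
      using e by (auto simp: \<phi>_def surj_f_inv_f[OF bij_is_surj[OF h(1)]] intro!: eq_vecI)
  qed (auto simp: \<phi>_def)
  then have inj: "inj_on ?f (carrier_vec n)" and surj: "?f ` carrier_vec n = carrier_vec n"
    by (simp_all add: bij_betw_def)
  have add: "?f (u + v) = ?f u + ?f v" if "u \<in> carrier_vec n" "v \<in> carrier_vec n" for u v
    using that by (intro eq_vecI) (auto simp: \<phi>_def h(2) algebra_simps)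
  have smult: "?f (a \<cdot>\<^sub>v u) = h a \<cdot>\<^sub>v ?f u" if "u \<in> carrier_vec n" for a u
    using that by (intro eq_vecI) (auto simp: \<phi>_def h(3) algebra_simps)
  have zero: "?f (0\<^sub>v n) = 0\<^sub>v n" by (intro eq_vecI) (auto simp: \<phi>_def h0)
  have image: "vec_subspace n (?f ` U) \<longleftrightarrow> vec_subspace n U" if UC: "U \<subseteq> carrier_vec n" for U
  proof
    assume U: "vec_subspace n U"
    have "?f u + ?f v \<in> ?f ` U" if "u \<in> U" "v \<in> U" for u v
      using add[of u v] that UC vec_subspace_add[OF U that] by (metis imageI subsetD)
    moreover have "a \<cdot>\<^sub>v ?f u \<in> ?f ` U" if "u \<in> U" for a u
    proof -
      have "a = h (inv_into UNIV h a)" using bij_is_surj[OF h(1)] by (simp add: surj_f_inv_f)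
      then have "a \<cdot>\<^sub>v ?f u = ?f (inv_into UNIV h a \<cdot>\<^sub>v u)" using smult[of u "inv_into UNIV h a"] that UC by auto
      then show ?thesis using vec_subspace_smult[OF U that] by simp
    qed
    moreover have "0\<^sub>v n \<in> ?f ` U" using zero vec_subspace_zero[OF U] by (metis imageI)
    ultimately show "vec_subspace n (?f ` U)" using fC by (auto simp: vec_subspace_def)
  next
    assume fU: "vec_subspace n (?f ` U)"
    have mem: "u \<in> U" if "u \<in> carrier_vec n" "?f u \<in> ?f ` U" for u
      using inj_on_image_mem_iff[OF inj that(1) UC] that(2) by simp
    have "0\<^sub>v n \<in> U" using mem[of "0\<^sub>v n"] zero vec_subspace_zero[OF fU] by simp
    moreover have "u + v \<in> U" if "u \<in> U" "v \<in> U" for u v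
    proof (rule mem)
      have uv: "u \<in> carrier_vec n" "v \<in> carrier_vec n" using that UC by auto
      then show "u + v \<in> carrier_vec n" by simp
      show "?f (u + v) \<in> ?f ` U"
        unfolding add[OF uv] using that by (intro vec_subspace_add[OF fU]) simp_all
    qed
    moreover have "a \<cdot>\<^sub>v u \<in> U" if "u \<in> U" for a u
    proof (rule mem)
      have u: "u \<in> carrier_vec n" using that UC by auto
      then show "a \<cdot>\<^sub>v u \<in> carrier_vec n" by simp
      show "?f (a \<cdot>\<^sub>v u) \<in> ?f ` U"
        unfolding smult[OF u] using that by (intro vec_subspace_smult[OF fU]) simp_all
    qed
    ultimately show "vec_subspace n U" using UC by (simp add: vec_subspace_def)
  qed
  have z: "{0\<^sub>v n} \<subseteq> carrier_vec n" by simp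
  have nontriv: "?f ` U \<in> nontrivial_subspaces n \<longleftrightarrow> U \<in> nontrivial_subspaces n"
    if UC: "U \<subseteq> carrier_vec n" for U
    using image[OF UC] inj_on_image_eq_iff[OF inj UC z] inj_on_image_eq_iff[OF inj UC order_refl]
    by (simp add: nontrivial_subspaces_iff zero surj)
  have sub: "U \<subseteq> carrier_vec n" if "U \<in> nontrivial_subspaces n" for U :: "'a vec set"
    using that by (simp add: nontrivial_subspaces_iff vec_subspace_def)
  have subb: "U \<subseteq> carrier_vec n" if "U \<in> nontrivial_subspaces n" for U :: "'b vec set"
    using that by (simp add: nontrivial_subspaces_iff vec_subspace_def)
  show ?thesis
  proof
    have "inj_on ((`) ?f) (nontrivial_subspaces n)"
      using inj_on_image_eq_iff[OF inj sub sub] by (auto intro: inj_onI)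
    moreover have "(`) ?f ` nontrivial_subspaces n = nontrivial_subspaces n"
    proof (intro equalityI subsetI)
      fix W :: "'b vec set" assume W: "W \<in> nontrivial_subspaces n"
      then have "W \<subseteq> ?f ` carrier_vec n" using subb surj by simp
      then obtain U where "U \<subseteq> carrier_vec n" "W = ?f ` U" by (auto simp: subset_image_iff)
      then show "W \<in> (`) ?f ` nontrivial_subspaces n" using nontriv W by blast
    qed (use nontriv sub in auto)
    ultimately show "bij_betw ((`) ?f) (nontrivial_subspaces n) (nontrivial_subspaces n)"
      by (simp add: bij_betw_def)
  next
    fix U W :: "'a vec set"
    assume UW: "U \<in> nontrivial_subspaces n" "W \<in> nontrivial_subspaces n"
    have "B2 (?f u) (?f w) = 0 \<longleftrightarrow> B1 u w = 0" if "u \<in> U" "w \<in> W" for u w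
      unfolding form[OF subsetD[OF sub[OF UW(1)] that(1)] subsetD[OF sub[OF UW(2)] that(2)]]
      using c hz by simp
    then show "orth B2 (?f ` U) (?f ` W) \<longleftrightarrow> orth B1 U W" by (simp add: orth_def)
  qed
qed

text \<open>
  For \<open>\<delta> = 1\<close> the factor \<open>c\<close> absorbs the quotient of the two entries, whether or not it is a square.
  For \<open>\<delta> = 2\<close> one can take \<open>c = 1\<close>: the image of \<open>z1\<close> is a non-square and hence a square times \<open>z2\<close>.
\<close>
lemma Delta_blocks_similar:
  fixes h :: "'a::{field,finite} \<Rightarrow> 'b::{field,finite}"
  assumes h: "bij h" "\<And>x y. h (x + y) = h x + h y" "\<And>x y. h (x * y) = h x * h y"
    and 1: "\<Delta>1 \<in> Delta_blocks z1 \<delta>" "\<nexists>x. z1 = x\<^sup>2"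
    and 2: "\<Delta>2 \<in> Delta_blocks z2 \<delta>" "\<nexists>x. z2 = x\<^sup>2"
  shows "\<exists>c t. c \<noteq> 0 \<and> (\<forall>k<\<delta>. t k \<noteq> 0 \<and> \<Delta>2 $$ (k, k) * (t k)\<^sup>2 = c * h (\<Delta>1 $$ (k, k)))"
proof -
  have h0: "h 0 = 0" by (rule additive_zero) (rule h(2))
  have hz: "h x = 0 \<longleftrightarrow> x = 0" for x using h0 bij_is_inj[OF h(1)] by (metis injD)
  have h1: "h 1 = 1" using h(3)[of 1 1] hz[of 1] by simp
  have hm: "h (- x) = - h x" for x using h(2)[of x "- x"] h0 by (simp add: eq_neg_iff_add_eq_0 add.commute)
  have nz: "\<Delta>1 $$ (k, k) \<noteq> 0" "\<Delta>2 $$ (k, k) \<noteq> 0" if "k < \<delta>" for k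
    using anisotropic_nonzero[OF Delta_blocks_diagonal(3)[OF 1] that]
      anisotropic_nonzero[OF Delta_blocks_diagonal(3)[OF 2] that] by auto
  consider "\<delta> = 0" | "\<delta> = 1" | "\<delta> = 2" "\<Delta>1 = mat_of_rows_list 2 [[1, 0], [0, - z1]]"
      "\<Delta>2 = mat_of_rows_list 2 [[1, 0], [0, - z2]]"
    using 1(1) 2(1) unfolding Delta_blocks_def by (auto split: if_splits)
  then show ?thesis
  proof cases
    case 1
    then show ?thesis by (auto intro: exI[of _ 1])
  next
    case 2
    then show ?thesis using nz[of 0] hz
      by (intro exI[of _ "\<Delta>2 $$ (0, 0) / h (\<Delta>1 $$ (0, 0))"] exI[of _ "\<lambda>_. 1"]) auto
  next
    case 3
    have "\<nexists>x. h z1 = x\<^sup>2"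
    proof
      assume "\<exists>x. h z1 = x\<^sup>2"
      then obtain x where "h z1 = x\<^sup>2" by blast
      moreover obtain y where "x = h y" using bij_is_surj[OF h(1)] by (metis surjD)
      ultimately have "h z1 = h (y\<^sup>2)" by (simp add: power2_eq_square h(3))
      then have "z1 = y\<^sup>2" using bij_is_inj[OF h(1)] by (simp add: injD)
      then show False using assms(5) by blast
    qed
    then obtain t where "t \<noteq> 0" "h z1 = t\<^sup>2 * z2"
      using quotient_of_non_squares_is_square[of "h z1" z2] assms(7) by blast
    then show ?thesis using 3
      by (intro exI[of _ 1] exI[of _ "\<lambda>k. if k = 0 then 1 else t"])
        (auto simp: mat_of_rows_list_def numeral_2_eq_2 less_Suc_eq h1 hm)
  qed
qed

text \<open>
  The similarity factor \<open>c\<close> of the blocks is realised on the hyperbolic part by multiplying only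
  the first \<open>\<nu>\<close> coordinates by \<open>c\<close>, since each of its products pairs one of them with one of the
  next \<open>\<nu>\<close>.
\<close>
lemma graph_iso_if_same_parameters:
  fixes \<Delta>1 :: "'a::{field,finite} mat" and \<Delta>2 :: "'b::{field,finite} mat"
  assumes card: "CARD('a) = CARD('b)"
    and 1: "\<Delta>1 \<in> Delta_blocks z1 \<delta>" "\<nexists>x. z1 = x\<^sup>2"
    and 2: "\<Delta>2 \<in> Delta_blocks z2 \<delta>" "\<nexists>x. z2 = x\<^sup>2"
  shows "\<exists>f. graph_iso (nontrivial_subspaces (2 * \<nu> + \<delta>)) (orth (witt_form \<nu> \<delta> (\<lambda>k. \<Delta>1 $$ (k, k))))
      (nontrivial_subspaces (2 * \<nu> + \<delta>)) (orth (witt_form \<nu> \<delta> (\<lambda>k. \<Delta>2 $$ (k, k)))) f"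
proof -
  obtain h :: "'a \<Rightarrow> 'b" where h: "bij h" "\<And>x y. h (x + y) = h x + h y" "\<And>x y. h (x * y) = h x * h y"
    using finite_fields_isomorphic_if_card_eq[OF card] by blast
  obtain c t where c: "c \<noteq> 0" and t: "\<And>k. k < \<delta> \<Longrightarrow> t k \<noteq> 0"
    "\<And>k. k < \<delta> \<Longrightarrow> \<Delta>2 $$ (k, k) * (t k)\<^sup>2 = c * h (\<Delta>1 $$ (k, k))"
    using Delta_blocks_similar[OF h 1 2] by blast
  let ?n = "2 * \<nu> + \<delta>"
  define e where "e i = (if i < \<nu> then c else if i < 2 * \<nu> then 1 else t (i - 2 * \<nu>))" for i
  have e: "i < \<nu> \<Longrightarrow> e i = c" "i < \<nu> \<Longrightarrow> e (\<nu> + i) = 1" "e (2 * \<nu> + k) = t k" for i k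
    by (simp_all add: e_def)
  have h0: "h 0 = 0" by (rule additive_zero) (rule h(2))
  have hsum: "h (\<Sum>i<m. g i) = (\<Sum>i<m. h (g i))" for m :: nat and g
    by (induction m) (simp_all add: h0 h(2))
  have "witt_form \<nu> \<delta> (\<lambda>k. \<Delta>2 $$ (k, k)) (vec ?n (\<lambda>i. e i * h (u $ i))) (vec ?n (\<lambda>i. e i * h (w $ i))) =
      c * h (witt_form \<nu> \<delta> (\<lambda>k. \<Delta>1 $$ (k, k)) u w)" for u w
  proof -
    let ?u = "vec ?n (\<lambda>i. e i * h (u $ i))" and ?w = "vec ?n (\<lambda>i. e i * h (w $ i))"
    have xy: "(\<Sum>i<\<nu>. ?u $ i * ?w $ (\<nu> + i)) = c * h (\<Sum>i<\<nu>. u $ i * w $ (\<nu> + i))"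
      unfolding hsum sum_distrib_left by (intro sum.cong) (simp_all add: e h(3))
    have yx: "(\<Sum>i<\<nu>. ?u $ (\<nu> + i) * ?w $ i) = c * h (\<Sum>i<\<nu>. u $ (\<nu> + i) * w $ i)"
      unfolding hsum sum_distrib_left by (intro sum.cong) (simp_all add: e h(3))
    have dd: "(\<Sum>k<\<delta>. \<Delta>2 $$ (k, k) * (?u $ (2 * \<nu> + k) * ?w $ (2 * \<nu> + k))) =
        c * h (\<Sum>k<\<delta>. \<Delta>1 $$ (k, k) * (u $ (2 * \<nu> + k) * w $ (2 * \<nu> + k)))"
      unfolding hsum sum_distrib_left
    proof (intro sum.cong refl)
      fix k assume "k \<in> {..<\<delta>}"
      then have k: "k < \<delta>" by simp
      have "\<Delta>2 $$ (k, k) * (?u $ (2 * \<nu> + k) * ?w $ (2 * \<nu> + k)) =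
          (\<Delta>2 $$ (k, k) * (t k)\<^sup>2) * (h (u $ (2 * \<nu> + k)) * h (w $ (2 * \<nu> + k)))"
        using k by (simp add: e power2_eq_square)
      also have "\<dots> = c * h (\<Delta>1 $$ (k, k) * (u $ (2 * \<nu> + k) * w $ (2 * \<nu> + k)))"
        unfolding t(2)[OF k] h(3) by (simp only: mult.assoc)
      finally show "\<Delta>2 $$ (k, k) * (?u $ (2 * \<nu> + k) * ?w $ (2 * \<nu> + k)) =
          c * h (\<Delta>1 $$ (k, k) * (u $ (2 * \<nu> + k) * w $ (2 * \<nu> + k)))" .
    qed
    show ?thesis
      unfolding witt_form_blocks xy yx dd h(2) by (simp only: distrib_left)
  qed
  moreover have "e i \<noteq> 0" if i: "i < ?n" for i
    by (rule block_index_cases[OF i]) (simp_all add: e c t(1))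
  ultimately show ?thesis
    using graph_iso_semilinear[OF h, of ?n e c "witt_form \<nu> \<delta> (\<lambda>k. \<Delta>2 $$ (k, k))"
      "witt_form \<nu> \<delta> (\<lambda>k. \<Delta>1 $$ (k, k))"] c by blast
qed

section \<open>The graphs of orthogonal spaces\<close>

lemma arc_Oi_iff:
  fixes \<Delta> :: "'a::{field,finite} mat"
  assumes "\<Delta> \<in> Delta_blocks z \<delta>" "\<nexists>x. z = x\<^sup>2"
    and U: "U \<in> nontrivial_subspaces (2 * \<nu> + \<delta>)" and W: "W \<in> nontrivial_subspaces (2 * \<nu> + \<delta>)"
  shows "(U, W) \<in> parcs (Oi \<nu> \<delta> \<Delta>) \<longleftrightarrow> orth (witt_form \<nu> \<delta> (\<lambda>k. \<Delta> $$ (k, k))) U W"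
proof -
  note \<Delta> = Delta_blocks_diagonal[OF assms(1,2)]
  have sU: "vec_subspace (2 * \<nu> + \<delta>) U" and sW: "vec_subspace (2 * \<nu> + \<delta>) W"
    using U W by (simp_all add: nontrivial_subspaces_iff)
  have "(U, W) \<in> parcs (Oi \<nu> \<delta> \<Delta>) \<longleftrightarrow> oi_adjacent (2 * \<nu> + \<delta>) (S_mat \<nu> \<delta> \<Delta>) U W"
    using U W by (simp add: Oi_def)
  also have "\<dots> \<longleftrightarrow> (\<forall>u\<in>U. \<forall>w\<in>W. u \<bullet> (S_mat \<nu> \<delta> \<Delta> *\<^sub>v w) = 0)"
    by (rule oi_adjacent_iff[OF S_mat_carrier[OF \<Delta>(1)] sU sW])
  also have "\<dots> \<longleftrightarrow> orth (witt_form \<nu> \<delta> (\<lambda>k. \<Delta> $$ (k, k))) U W"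
    unfolding orth_def
    by (intro ball_cong refl) (simp only: scalar_prod_S_mat[where D = "\<lambda>k. \<Delta> $$ (k, k)", OF \<Delta>(1,2)
      vec_subspace_carrier[OF sU] vec_subspace_carrier[OF sW]])
  finally show ?thesis .
qed

lemma digraph_iso_Oi_iff:
  fixes \<Delta>1 :: "'a::{field,finite} mat" and \<Delta>2 :: "'b::{field,finite} mat"
  assumes 1: "\<Delta>1 \<in> Delta_blocks z1 \<delta>1" "\<nexists>x. z1 = x\<^sup>2"
    and 2: "\<Delta>2 \<in> Delta_blocks z2 \<delta>2" "\<nexists>x. z2 = x\<^sup>2"
  shows "digraph_iso (with_proj (Oi \<nu>1 \<delta>1 \<Delta>1)) (with_proj (Oi \<nu>2 \<delta>2 \<Delta>2)) \<longleftrightarrow>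
    (\<exists>f. graph_iso (nontrivial_subspaces (2 * \<nu>1 + \<delta>1)) (orth (witt_form \<nu>1 \<delta>1 (\<lambda>k. \<Delta>1 $$ (k, k))))
      (nontrivial_subspaces (2 * \<nu>2 + \<delta>2)) (orth (witt_form \<nu>2 \<delta>2 (\<lambda>k. \<Delta>2 $$ (k, k)))) f)"
proof -
  have wf: "pair_wf_digraph (Oi \<nu>1 \<delta>1 \<Delta>1)" "pair_wf_digraph (Oi \<nu>2 \<delta>2 \<Delta>2)"
    by (unfold_locales; auto simp: Oi_def)+
  have verts: "pverts (Oi \<nu>1 \<delta>1 \<Delta>1) = nontrivial_subspaces (2 * \<nu>1 + \<delta>1)"
    "pverts (Oi \<nu>2 \<delta>2 \<Delta>2) = nontrivial_subspaces (2 * \<nu>2 + \<delta>2)"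
    by (simp_all add: Oi_def)
  have "(bij_betw f V W \<and> (\<forall>u\<in>V. \<forall>v\<in>V. (u, v) \<in> parcs (Oi \<nu>1 \<delta>1 \<Delta>1) \<longleftrightarrow> (f u, f v) \<in> parcs (Oi \<nu>2 \<delta>2 \<Delta>2)))
      \<longleftrightarrow> graph_iso V (orth (witt_form \<nu>1 \<delta>1 (\<lambda>k. \<Delta>1 $$ (k, k))))
        W (orth (witt_form \<nu>2 \<delta>2 (\<lambda>k. \<Delta>2 $$ (k, k)))) f"
    if V: "V = nontrivial_subspaces (2 * \<nu>1 + \<delta>1)" and W: "W = nontrivial_subspaces (2 * \<nu>2 + \<delta>2)" for f V W
  proof (cases "bij_betw f V W")
    case True
    then have fW: "f u \<in> W" if "u \<in> V" for u using that by (rule bij_betwE[THEN bspec])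
    have "(u, v) \<in> parcs (Oi \<nu>1 \<delta>1 \<Delta>1) \<longleftrightarrow> orth (witt_form \<nu>1 \<delta>1 (\<lambda>k. \<Delta>1 $$ (k, k))) u v"
      and "(f u, f v) \<in> parcs (Oi \<nu>2 \<delta>2 \<Delta>2) \<longleftrightarrow> orth (witt_form \<nu>2 \<delta>2 (\<lambda>k. \<Delta>2 $$ (k, k))) (f u) (f v)"
      if "u \<in> V" "v \<in> V" for u v
      using arc_Oi_iff[OF 1] arc_Oi_iff[OF 2] that fW V W by simp_all
    then show ?thesis using True by (auto simp: graph_iso_def)
  qed (simp add: graph_iso_def)
  then show ?thesis
    unfolding digraph_iso_with_proj_iff[OF wf] verts by blast
qed

theorem theorem2p2:
  fixes z1 :: "'a::{field,finite}" and z2 :: "'b::{field,finite}"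
    and \<Delta>1 :: "'a mat" and \<Delta>2 :: "'b mat"
    and \<nu>1 \<nu>2 \<delta>1 \<delta>2 :: nat
  assumes "odd CHAR('a)" and "odd CHAR('b)"
    and "z1 \<noteq> 0" "\<not> (\<exists>x. z1 = x\<^sup>2)"
    and "z2 \<noteq> 0" "\<not> (\<exists>x. z2 = x\<^sup>2)"
    and "\<delta>1 \<in> {0, 1, 2}" and "\<delta>2 \<in> {0, 1, 2}"
    and "2 * \<nu>1 + \<delta>1 \<ge> 2" and "2 * \<nu>2 + \<delta>2 \<ge> 2"
    and "\<Delta>1 \<in> Delta_blocks z1 \<delta>1" and "\<Delta>2 \<in> Delta_blocks z2 \<delta>2"
  shows "digraph_iso (with_proj (Oi \<nu>1 \<delta>1 \<Delta>1)) (with_proj (Oi \<nu>2 \<delta>2 \<Delta>2)) \<longleftrightarrow>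
         \<nu>1 = \<nu>2 \<and> \<delta>1 = \<delta>2 \<and> CARD('a) = CARD('b)"
  unfolding digraph_iso_Oi_iff[OF assms(11,4,12,6)]
proof
  assume "\<exists>f. graph_iso (nontrivial_subspaces (2 * \<nu>1 + \<delta>1)) (orth (witt_form \<nu>1 \<delta>1 (\<lambda>k. \<Delta>1 $$ (k, k))))
    (nontrivial_subspaces (2 * \<nu>2 + \<delta>2)) (orth (witt_form \<nu>2 \<delta>2 (\<lambda>k. \<Delta>2 $$ (k, k)))) f"
  then obtain f where iso: "graph_iso (nontrivial_subspaces (2 * \<nu>1 + \<delta>1))
    (orth (witt_form \<nu>1 \<delta>1 (\<lambda>k. \<Delta>1 $$ (k, k)))) (nontrivial_subspaces (2 * \<nu>2 + \<delta>2))
    (orth (witt_form \<nu>2 \<delta>2 (\<lambda>k. \<Delta>2 $$ (k, k)))) f" by blast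
  note D = Delta_blocks_diagonal(3)[OF assms(11,4)] Delta_blocks_diagonal(3)[OF assms(12,6)]
  note inv = orthogonality_graph_determines_cardinalities[OF nondegenerate_symmetric_form_witt_form[OF D(1)]
    nondegenerate_symmetric_form_witt_form[OF D(2)] assms(9,10) iso]
  have "\<nu>1 = \<nu>2" by (rule same_witt_index[OF D assms(9,10) iso inv(1,3)])
  then show "\<nu>1 = \<nu>2 \<and> \<delta>1 = \<delta>2 \<and> CARD('a) = CARD('b)" using inv(1,2) by simp
next
  assume "\<nu>1 = \<nu>2 \<and> \<delta>1 = \<delta>2 \<and> CARD('a) = CARD('b)"
  then show "\<exists>f. graph_iso (nontrivial_subspaces (2 * \<nu>1 + \<delta>1)) (orth (witt_form \<nu>1 \<delta>1 (\<lambda>k. \<Delta>1 $$ (k, k))))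
    (nontrivial_subspaces (2 * \<nu>2 + \<delta>2)) (orth (witt_form \<nu>2 \<delta>2 (\<lambda>k. \<Delta>2 $$ (k, k)))) f"
    using graph_iso_if_same_parameters[OF _ assms(11,4), of \<Delta>2 z2 \<nu>1] assms(6,12) by simp
qed

end
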